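(* There exists a constant $c>0$ such that for all $n,d\in\mathbb{N}=\{1,2,\dots\}$, $\varepsilon\in(0,1/2)$, and $t\in\mathbb{N}$ the following holds. Put $\bar t=\max\{t,2\}$ and suppose $d<n/11$ and $\bar t\log^7\bar t\le c\cdot\varepsilon^{2.5}d^{-7}2^{(n-11d)/2}$. Then there exists an $\varepsilon$-tester for the property $\mathcal{P}_d$ of functions $f:\{0,1\}^n\to\{0,1\}$ that works in the presence of a $t$-online erasure budget-managing adversary with batch size $2^{d-1}$ and makes $O\left(1/\varepsilon+2^{3d}(d+\log\bar t)^3\right)$ queries (with an absolute constant in the $O(\cdot)$).
   Context: $\log$ is base 2. $\mathcal{P}_d$ is the set of functions $\{0,1\}^n\to\{0,1\}$ that can be written as a sum mod 2 of monomials $\prod_{i\in S}x[i]$ with $S\subseteq[n]$, $|S|\le d$ ($S=\emptyset$ allowed). Online model with batches. The input is a function $f$ on a finite domain. Access is via a sequence of oracles $\mathcal{O}_1,\mathcal{O}_2,\dots$ with $\mathcal{O}_1=f$; with batch size $b$, oracle $\mathcal{O}_i$ answers the $i$-th batch of $b$ queries. After each batch the adversary chooses the next oracle; its strategy may depend on the input, the tester's description, and all queries made so far, but not on the tester's future coin tosses. Let $\mathrm{Dist}$ denote Hamming distance (number of points with different answers). A $t$-online budget-managing adversary must satisfy $\mathrm{Dist}(\mathcal{O}_1,\mathcal{O}_{i+1})\le i\cdot t$ for all $i\in\mathbb{N}$. An erasure adversary must satisfy $\mathcal{O}_{i+1}(x)\in\{\mathcal{O}_i(x),\perp\}$ for all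 $x$ ($\perp$ is the erasure symbol). Query complexity counts the total number of individual queries, regardless of batch size. $f$ is $\varepsilon$-far from a property $\mathcal{P}$ if at least an $\varepsilon$ fraction of the values of $f$ must be changed to obtain a function in $\mathcal{P}$. An (online) $\varepsilon$-tester for $\mathcal{P}$ working in the presence of a given type of adversary is a randomized algorithm that, for every adversarial strategy of that type, accepts with probability at least $2/3$ if $f\in\mathcal{P}$ and rejects with probability at least $2/3$ if $f$ is $\varepsilon$-far from $\mathcal{P}$. *)

theory Defs
  imports "HOL-Probability.Probability" "HOL-Library.Z2" "HOL-Library.Extended_Nat"
begin

section \<open>Boolean functions of low degree\<close>

definition cube :: "nat \<Rightarrow> (nat \<Rightarrow> bit) set" where
  "cube n = {1..n} \<rightarrow>\<^sub>E UNIV"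

text \<open>Arithmetic in \<open>bit\<close> is arithmetic modulo 2. Values of the functions outside
  \<open>cube n\<close> are irrelevant throughout.\<close>

definition low_degree :: "nat \<Rightarrow> nat \<Rightarrow> ((nat \<Rightarrow> bit) \<Rightarrow> bit) set" where
  "low_degree n d =
     {f. \<exists>M \<subseteq> {S. S \<subseteq> {1..n} \<and> card S \<le> d}.
           \<forall>x\<in>cube n. f x = (\<Sum>S\<in>M. \<Prod>i\<in>S. x i)}"

definition hamming_dist :: "'a set \<Rightarrow> ('a \<Rightarrow> 'c) \<Rightarrow> ('a \<Rightarrow> 'c) \<Rightarrow> nat" where
  "hamming_dist X f g = card {x \<in> X. f x \<noteq> g x}"

definition far_from :: "'a set \<Rightarrow> real \<Rightarrow> ('a \<Rightarrow> 'b) set \<Rightarrow> ('a \<Rightarrow> 'b) \<Rightarrow> bool" where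
  "far_from X \<epsilon> P f \<longleftrightarrow> (\<forall>g\<in>P. real (hamming_dist X f g) \<ge> \<epsilon> * real (card X))"

section \<open>Randomized query algorithms\<close>

text \<open>An algorithm halts with a verdict (\<open>True\<close> is accept), or queries a point and continues
  depending on the answer, or tosses coins to determine its continuation. The answer \<open>None\<close>
  is the erasure symbol. The generated set function \<open>queried\<close> collects all points queried
  on any computation path.\<close>

datatype (queried: 'a, dead 'b) algorithm =
    Halt bool
  | Query 'a "'b option \<Rightarrow> ('a, 'b) algorithm"
  | Toss "('a, 'b) algorithm pmf"

text \<open>The largest number of queries on any computation path.\<close>

primrec query_complexity :: "('a, 'b) algorithm \<Rightarrow> enat" where
  "query_complexity (Halt v) = 0"
| "query_complexity (Query x k) = eSuc (SUP a. query_complexity (k a))"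
| "query_complexity (Toss p) = Sup (set_pmf (map_pmf query_complexity p))"

section \<open>Online adversaries with batches\<close>

text \<open>A strategy maps the list of queries made in the first \<open>i\<close> batches (of length \<open>i * b\<close>) to
  the oracle that answers batch \<open>i + 1\<close>; its values on lists of other lengths are never used.
  It is chosen with knowledge of the input and of the algorithm, but observes only the queries.\<close>

type_synonym ('a, 'b) strategy = "'a list \<Rightarrow> 'a \<Rightarrow> 'b option"

definition erasure_budget_adversary ::
  "'a set \<Rightarrow> nat \<Rightarrow> nat \<Rightarrow> ('a \<Rightarrow> 'b) \<Rightarrow> ('a, 'b) strategy \<Rightarrow> bool" where
  "erasure_budget_adversary X b t f A \<longleftrightarrow>
     (\<forall>x\<in>X. A [] x = Some (f x)) \<and>
     (\<forall>i qs. set qs \<subseteq> X \<and> length qs = i * b \<longrightarrow> hamming_dist X (A []) (A qs) \<le> i * t) \<and>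
     (\<forall>i qs batch. set qs \<subseteq> X \<and> set batch \<subseteq> X \<and> length qs = i * b \<and> length batch = b \<longrightarrow>
        (\<forall>x\<in>X. A (qs @ batch) x \<in> {A qs x, None}))"

text \<open>\<open>run b A T qs\<close> is the distribution of the verdict of \<open>T\<close> when the queries \<open>qs\<close> have already
  been made. The strategy sees only the completed batches; queries in one batch are answered by
  the same oracle and may depend on earlier answers in that batch.\<close>

primrec run ::
  "nat \<Rightarrow> ('a, 'b) strategy \<Rightarrow> ('a, 'b) algorithm \<Rightarrow> 'a list \<Rightarrow> bool pmf" where
  "run b A (Halt v) = (\<lambda>qs. return_pmf v)"
| "run b A (Query x k) =
     (\<lambda>qs. run b A (k (A (take (length qs div b * b) qs) x)) (qs @ [x]))"
| "run b A (Toss p) = (\<lambda>qs. bind_pmf (map_pmf (run b A) p) (\<lambda>r. r qs))"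

lemma run_Toss: "run b A (Toss p) qs = bind_pmf p (\<lambda>T. run b A T qs)"
  by (simp add: bind_map_pmf)

definition online_erasure_tester ::
  "'a set \<Rightarrow> ('a \<Rightarrow> 'b) set \<Rightarrow> real \<Rightarrow> nat \<Rightarrow> nat \<Rightarrow> ('a, 'b) algorithm \<Rightarrow> bool" where
  "online_erasure_tester X P \<epsilon> b t T \<longleftrightarrow>
     queried T \<subseteq> X \<and>
     (\<forall>f A. erasure_budget_adversary X b t f A \<longrightarrow>
        (f \<in> P \<longrightarrow> pmf (run b A T []) True \<ge> 2/3) \<and>
        (far_from X \<epsilon> P f \<longrightarrow> pmf (run b A T []) False \<ge> 2/3))"

end

theory Submission
  imports Defs "HOL-Library.Function_Algebras"
begin

text \<open>Summing \<open>f\<close> over the cosets of a random \<open>(d - 1)\<close>-dimensional subspace \<open>H\<close> gives a function \<open>F\<close>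
  that is affine whenever \<open>f\<close> has degree at most \<open>d\<close>, and one batch of \<open>2 ^ (d - 1)\<close> queries reveals
  exactly one value of \<open>F\<close>. A round of the tester queries \<open>F\<close> at \<open>s\<close> pairs of random points,
  with \<open>s\<close> odd, selects one point of each pair by a fair coin, queries \<open>F\<close> at the sum of the
  selected points and compares. The adversary cannot aim at the last batch: by a collision bound,
  the sum is spread over about \<open>min (2 ^ s) (2 ^ n)\<close> points. The other batches are uniformly
  random cosets. All queries are nonadaptive, so erasures are bounded separately from rejections.

  For soundness, let \<open>\<rho>\<close> be the probability that the sum of \<open>f\<close> over a random \<open>(d + 1)\<close>-flat is
  nonzero. Two comparisons sharing all but two points form a flat test, so a round rejects with
  probability at least \<open>\<rho> / 2\<close> on average over \<open>H\<close>. If \<open>\<rho>\<close> is below a constant times \<open>4 ^ (- d)\<close>,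
  then self-correction shows that \<open>f\<close> is \<open>2\<rho>\<close>-close to degree \<open>d\<close>. In that case \<open>F\<close> is affine
  up to the indicator of a sparse set, and the parity of \<open>s - 1\<close> independent samples from this set
  makes a round reject with probability proportional to \<open>min 1 (s 2 ^ d \<epsilon>)\<close>. This saves the factor
  \<open>log t\<close> in front of \<open>1 / \<epsilon>\<close>.\<close>

section \<open>Averages over finite sets\<close>

text \<open>Expectation under the uniform distribution on \<open>A\<close>. Probabilities are
  averages of \<open>of_bool\<close>, so independence and exchange of expectations reduce to finite
  sums.\<close>

definition avg :: "'a set \<Rightarrow> ('a \<Rightarrow> real) \<Rightarrow> real" where
  "avg A \<phi> = (\<Sum>x\<in>A. \<phi> x) / real (card A)"

text \<open>Averages over \<open>tuples k A\<close> model \<open>k\<close> independent uniform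
  samples from \<open>A\<close>.\<close>

definition tuples :: "nat \<Rightarrow> 'a set \<Rightarrow> 'a list set" where
  "tuples k A = {xs. set xs \<subseteq> A \<and> length xs = k}"

lemma avg_mono: "(\<And>x. x \<in> A \<Longrightarrow> \<phi> x \<le> \<psi> x) \<Longrightarrow> avg A \<phi> \<le> avg A \<psi>"
  unfolding avg_def by (intro divide_right_mono sum_mono) auto

lemma avg_cong: "(\<And>x. x \<in> A \<Longrightarrow> \<phi> x = \<psi> x) \<Longrightarrow> avg A \<phi> = avg A \<psi>"
  unfolding avg_def by (auto intro: sum.cong)

lemma avg_add: "avg A (\<lambda>x. \<phi> x + \<psi> x) = avg A \<phi> + avg A \<psi>"
  unfolding avg_def by (simp add: sum.distrib add_divide_distrib)

lemma avg_cmult: "avg A (\<lambda>x. c * \<phi> x) = c * avg A \<phi>"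
  unfolding avg_def by (simp flip: sum_distrib_left)

lemma avg_multc: "avg A (\<lambda>x. \<phi> x * c) = avg A \<phi> * c"
  unfolding avg_def by (simp flip: sum_distrib_right)

lemma avg_const: "finite A \<Longrightarrow> A \<noteq> {} \<Longrightarrow> avg A (\<lambda>_. c) = c"
  unfolding avg_def by simp

lemma avg_diff: "avg A (\<lambda>x. \<phi> x - \<psi> x) = avg A \<phi> - avg A \<psi>"
  unfolding avg_def by (simp add: sum_subtractf diff_divide_distrib)

lemma avg_le_const:
  assumes "finite A" "A \<noteq> {}" "\<And>x. x \<in> A \<Longrightarrow> \<phi> x \<le> c"
  shows "avg A \<phi> \<le> c"
  using avg_mono[of A \<phi> "\<lambda>_. c"] assms by (simp add: avg_const)

lemma avg_nonneg: "(\<And>x. x \<in> A \<Longrightarrow> 0 \<le> \<phi> x) \<Longrightarrow> 0 \<le> avg A \<phi>"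
  unfolding avg_def by (intro divide_nonneg_nonneg sum_nonneg) auto

lemma avg_swap: "avg A (\<lambda>x. avg B (\<lambda>y. \<phi> x y)) = avg B (\<lambda>y. avg A (\<lambda>x. \<phi> x y))"
  unfolding avg_def sum_divide_distrib[symmetric] by (subst sum.swap) (simp add: mult.commute)

lemma avg_Times: "avg (A \<times> B) \<phi> = avg A (\<lambda>x. avg B (\<lambda>y. \<phi> (x, y)))"
  unfolding avg_def sum_divide_distrib[symmetric] sum.cartesian_product card_cartesian_product
  by (simp add: mult.commute)

lemma avg_reindex: "bij_betw h A B \<Longrightarrow> avg A (\<lambda>x. \<phi> (h x)) = avg B \<phi>"
  unfolding avg_def by (simp add: sum.reindex_bij_betw bij_betw_same_card)

lemma avg_of_bool: "finite A \<Longrightarrow> avg A (\<lambda>x. of_bool (P x)) = real (card {x \<in> A. P x}) / real (card A)"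
  unfolding avg_def by (simp add: Int_def)

lemma avg_of_bool_not:
  assumes "finite A" "A \<noteq> {}"
  shows "avg A (\<lambda>x. of_bool (\<not> P x)) = 1 - avg A (\<lambda>x. of_bool (P x))"
proof -
  have "avg A (\<lambda>x. of_bool (\<not> P x)) = avg A (\<lambda>x. 1 - of_bool (P x))"
    by (rule avg_cong) auto
  then show ?thesis using assms by (simp add: avg_diff avg_const)
qed

lemma avg_of_bool_range:
  assumes "finite A" "A \<noteq> {}"
  shows "0 \<le> avg A (\<lambda>x. of_bool (P x))" "avg A (\<lambda>x. of_bool (P x)) \<le> 1"
  using assms by (auto intro!: avg_nonneg avg_le_const)

text \<open>For truth values \<open>p\<close>, \<open>q\<close> the indicator of
  \<open>p \<noteq> q\<close> is \<open>p + q - 2 * p * q\<close>, and the two samples are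
  independent.\<close>

lemma avg_neq:
  fixes P :: "'a \<Rightarrow> bool"
  assumes "finite A" "A \<noteq> {}"
  defines "a \<equiv> avg A (\<lambda>x. of_bool (P x))"
  shows "avg A (\<lambda>x. avg A (\<lambda>y. of_bool (P x \<noteq> P y))) = 2 * a * (1 - a)"
proof -
  have "avg A (\<lambda>x. avg A (\<lambda>y. of_bool (P x \<noteq> P y)))
      = avg A (\<lambda>x. avg A (\<lambda>y. of_bool (P x) + of_bool (P y) - 2 * (of_bool (P x) * of_bool (P y))))"
    by (intro avg_cong) auto
  also have "\<dots> = 2 * a * (1 - a)"
    using assms(1,2) by (simp add: avg_diff avg_add avg_cmult avg_multc avg_const a_def algebra_simps)
  finally show ?thesis .
qed

lemma tuples_0 [simp]: "tuples 0 A = {[]}"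
  by (auto simp: tuples_def)

lemma bij_betw_tuples_Suc:
  "bij_betw (\<lambda>(x, xs). x # xs) (A \<times> tuples k A) (tuples (Suc k) A)"
  unfolding bij_betw_def inj_on_def
  by (auto simp: tuples_def length_Suc_conv image_iff)

lemma avg_singleton [simp]: "avg {a} \<phi> = \<phi> a"
  by (simp add: avg_def)

lemma avg_tuples_Suc:
  "avg (tuples (Suc k) A) \<phi> = avg A (\<lambda>x. avg (tuples k A) (\<lambda>xs. \<phi> (x # xs)))"
  using avg_reindex[OF bij_betw_tuples_Suc, where \<phi> = \<phi>] by (simp add: avg_Times)

lemma avg_tuples_append:
  "avg (tuples (i + j) A) \<phi> = avg (tuples i A) (\<lambda>xs. avg (tuples j A) (\<lambda>ys. \<phi> (xs @ ys)))"
  by (induction i arbitrary: \<phi>) (auto simp: avg_tuples_Suc)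

lemma finite_tuples [simp]: "finite A \<Longrightarrow> finite (tuples k A)"
  unfolding tuples_def by (simp add: finite_lists_length_eq)

lemma tuples_nonempty [simp]: "A \<noteq> {} \<Longrightarrow> tuples k A \<noteq> {}"
proof -
  assume "A \<noteq> {}"
  then obtain a where "a \<in> A" by auto
  then have "replicate k a \<in> tuples k A" by (auto simp: tuples_def)
  then show ?thesis by auto
qed

lemma avg_tuples_all:
  "avg (tuples m A) (\<lambda>xs. of_bool (\<forall>x\<in>set xs. P x)) = avg A (\<lambda>x. of_bool (P x)) ^ m"
proof (induction m)
  case (Suc m)
  have "avg (tuples (Suc m) A) (\<lambda>xs. of_bool (\<forall>x\<in>set xs. P x))
     = avg A (\<lambda>x. avg (tuples m A) (\<lambda>xs. of_bool (P x) * of_bool (\<forall>x\<in>set xs. P x)))"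
    unfolding avg_tuples_Suc by (intro avg_cong) auto
  then show ?case by (simp add: avg_cmult avg_multc Suc)
qed simp

declare add_bit_eq_xor [simp del] mult_bit_eq_and [simp del]

section \<open>Iterated differences over a Boolean group\<close>

text \<open>Discrete derivative in the directions \<open>hs\<close>. In a Boolean group it is the
  sum of \<open>f\<close> over the flat through \<open>x\<close> spanned by \<open>hs\<close>; for
  dependent directions the points repeat an even number of times and the value is 0.\<close>

primrec iter_diff :: "'v::ab_group_add list \<Rightarrow> ('v \<Rightarrow> bit) \<Rightarrow> 'v \<Rightarrow> bit" where
  "iter_diff [] f = f"
| "iter_diff (h # hs) f = (\<lambda>x. iter_diff hs f x + iter_diff hs f (x + h))"

text \<open>A list with repetitions, so that \<open>d - 1\<close> directions always fill exactly one
  batch, even when they are dependent.\<close>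

primrec pts :: "'v::ab_group_add list \<Rightarrow> 'v \<Rightarrow> 'v list" where
  "pts [] = (\<lambda>x. [x])"
| "pts (h # hs) = (\<lambda>x. pts hs x @ pts hs (x + h))"

lemma length_pts [simp]: "length (pts hs x) = 2 ^ length hs"
  by (induction hs arbitrary: x) auto

lemma iter_diff_eq_sum_list: "iter_diff hs f x = sum_list (map f (pts hs x))"
  by (induction hs arbitrary: x) auto

text \<open>Differences in several directions commute, so a direction at any position can be split
  off.\<close>

lemma iter_diff_insert: "iter_diff (as @ h # bs) f x = iter_diff (as @ bs) f x + iter_diff (as @ bs) f (x + h)"
  by (induction as arbitrary: x) (auto simp: ac_simps)

lemma iter_diff_add: "iter_diff hs (\<lambda>x. f x + g x) x = iter_diff hs f x + iter_diff hs g x"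
  by (induction hs arbitrary: x) (auto simp: ac_simps)

lemma iter_diff_translate: "iter_diff hs (\<lambda>y. f (y + a)) x = iter_diff hs f (x + a)"
  by (induction hs arbitrary: x) (auto simp: ac_simps)

lemma iter_diff_Cons: "iter_diff (h # hs) f x = iter_diff hs (\<lambda>y. f y + f (y + h)) x"
  by (simp add: iter_diff_add iter_diff_translate)

lemma iter_diff_append: "iter_diff (as @ bs) f = iter_diff as (iter_diff bs f)"
  by (induction as) auto

lemma bit_add_self [simp]: "(a::bit) + a = 0" "a + (a + b) = b"
  by (cases a; cases b; simp)+

lemma bit_add_eq_0: "(a::bit) + b = 0 \<longleftrightarrow> a = b"
  by (cases a; cases b; simp)

text \<open>The group is a carrier set inside a type because the cube will be realised by the
  functions on \<open>nat\<close> that vanish outside \<open>{1..n}\<close>.\<close>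

locale boolean_group =
  fixes W :: "'v::ab_group_add set"
  assumes finite_W [simp]: "finite W"
    and zero_W [simp]: "0 \<in> W"
    and add_W [simp]: "x \<in> W \<Longrightarrow> y \<in> W \<Longrightarrow> x + y \<in> W"
    and add_self: "x \<in> W \<Longrightarrow> x + x = 0"
begin

lemma W_nonempty [simp]: "W \<noteq> {}"
  using zero_W by blast

abbreviation L where "L k \<equiv> tuples k W"

lemma L_Cons [simp]: "x # xs \<in> L (Suc k) \<longleftrightarrow> x \<in> W \<and> xs \<in> L k"
  by (auto simp: tuples_def)

lemma add_self2 [simp]: "x \<in> W \<Longrightarrow> x + (x + y) = y" "x \<in> W \<Longrightarrow> (y + x) + x = y"
  by (metis add_self add.assoc add_0, metis add_self add.assoc add_0_right)

lemma pts_W: "set hs \<subseteq> W \<Longrightarrow> x \<in> W \<Longrightarrow> set (pts hs x) \<subseteq> W"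
  by (induction hs arbitrary: x) auto

lemma iter_diff_cong:
  assumes "\<And>x. x \<in> W \<Longrightarrow> f x = g x" "set hs \<subseteq> W" "x \<in> W"
  shows "iter_diff hs f x = iter_diff hs g x"
  using assms(2,3) by (induction hs arbitrary: x) (auto simp: assms(1))

lemma avg_translate: "a \<in> W \<Longrightarrow> avg W (\<lambda>x. \<phi> (x + a)) = avg W \<phi>"
  by (rule avg_reindex, rule bij_betwI[of _ _ _ "\<lambda>x. x + a"]) auto

lemma avg_translate': "a \<in> W \<Longrightarrow> avg W (\<lambda>x. \<phi> (a + x)) = avg W \<phi>"
  using avg_translate[of a \<phi>] by (simp add: add.commute)

end

lemma of_bool_le_add: "(P \<Longrightarrow> Q \<or> R) \<Longrightarrow> (of_bool P :: real) \<le> of_bool Q + of_bool R"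
  by (auto simp: of_bool_def)

section \<open>Rejection probability of the flat test and exchange of directions\<close>

context boolean_group
begin

lemma tuples_W: "xs \<in> L k \<longleftrightarrow> set xs \<subseteq> W \<and> length xs = k"
  by (simp add: tuples_def)

lemma L_nonempty [simp]: "L k \<noteq> {}" and finite_L [simp]: "finite (L k)"
  by simp_all

lemma avg_const_W [simp]: "avg W (\<lambda>_. c) = c" and avg_const_L [simp]: "avg (L k) (\<lambda>_. c) = c"
  by (simp_all add: avg_const)

text \<open>Base point and directions are uniform and independent. The quantity \<rho> of the flat
  test for degree \<open>d\<close> is \<open>rejection (d + 1) f\<close>.\<close>

definition rejection :: "nat \<Rightarrow> ('v \<Rightarrow> bit) \<Rightarrow> real" where
  "rejection k f = avg W (\<lambda>x. avg (L k) (\<lambda>hs. of_bool (iter_diff hs f x \<noteq> 0)))"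

lemma rejection_nonneg: "0 \<le> rejection k f"
  unfolding rejection_def by (intro avg_nonneg) simp

lemma avg_snoc:
  "avg (L (Suc i)) \<phi> = avg (L i) (\<lambda>as. avg W (\<lambda>h. \<phi> (as @ [h])))"
  using avg_tuples_append[of i 1 W \<phi>] by (simp add: avg_tuples_Suc)

text \<open>The differences along \<open>h\<close> and \<open>h'\<close> share the term at
  \<open>x\<close>, which cancels in characteristic 2; what remains is the difference along
  \<open>h + h'\<close> at \<open>x + h\<close>. This pair of direction and base point is again
  uniform, although \<open>x\<close> is fixed.\<close>

lemma rejection_insert:
  assumes "x \<in> W"
  shows "avg W (\<lambda>h. avg (L i) (\<lambda>as. avg W (\<lambda>h'. avg (L j) (\<lambda>bs.
    of_bool (iter_diff (as @ h # bs) f x \<noteq> iter_diff (as @ h' # bs) f x))))) = rejection (i + Suc j) f"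
    (is "?l = _")
proof -
  have "?l = avg W (\<lambda>h. avg (L i) (\<lambda>as. avg W (\<lambda>h'. avg (L j) (\<lambda>bs.
    of_bool (iter_diff (as @ (h + h') # bs) f (x + h) \<noteq> 0)))))"
  proof (intro avg_cong)
    fix h as h' bs assume "h \<in> W" "h' \<in> W"
    then have eq: "x + h + (h + h') = x + h'"
      using add_self2[of h] by (metis add.assoc)
    have "iter_diff (as @ (h + h') # bs) f (x + h)
      = iter_diff (as @ h # bs) f x + iter_diff (as @ h' # bs) f x"
      unfolding iter_diff_insert eq by (simp add: ac_simps)
    then show "of_bool (iter_diff (as @ h # bs) f x \<noteq> iter_diff (as @ h' # bs) f x)
      = (of_bool (iter_diff (as @ (h + h') # bs) f (x + h) \<noteq> 0) :: real)"
      by (simp only: bit_add_eq_0)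
  qed
  also have "\<dots> = avg W (\<lambda>h. avg (L i) (\<lambda>as. avg W (\<lambda>h'. avg (L j) (\<lambda>bs.
    of_bool (iter_diff (as @ h' # bs) f (x + h) \<noteq> 0)))))"
    by (intro avg_cong avg_translate')
  also have "\<dots> = avg W (\<lambda>h. avg (L (i + Suc j)) (\<lambda>hs. of_bool (iter_diff hs f (x + h) \<noteq> 0)))"
    by (simp only: avg_tuples_append avg_tuples_Suc)
  also have "\<dots> = rejection (i + Suc j) f"
    unfolding rejection_def
    by (rule avg_translate'[OF assms, of "\<lambda>y. avg (L (i + Suc j)) (\<lambda>hs. of_bool (iter_diff hs f y \<noteq> 0))"])
  finally show ?thesis .
qed

text \<open>Hybrid argument: the directions are exchanged one at a time.\<close>

lemma rejection_hybrid:
  assumes "x \<in> W"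
  shows "avg (L i) (\<lambda>as. avg (L j) (\<lambda>hs. avg (L j) (\<lambda>hs'.
     of_bool (iter_diff (as @ hs) f x \<noteq> iter_diff (as @ hs') f x)))) \<le> real j * rejection (i + j) f"
proof (induction j arbitrary: i)
  case 0
  then show ?case by simp
next
  case (Suc j)
  let ?D = "\<lambda>hs. iter_diff hs f x"
  have "avg (L i) (\<lambda>as. avg (L (Suc j)) (\<lambda>hs. avg (L (Suc j)) (\<lambda>hs'. of_bool (?D (as @ hs) \<noteq> ?D (as @ hs')))))
    = avg (L i) (\<lambda>as. avg W (\<lambda>h. avg (L j) (\<lambda>bs. avg W (\<lambda>h'. avg (L j) (\<lambda>bs'.
        of_bool (?D (as @ h # bs) \<noteq> ?D (as @ h' # bs')))))))"
    by (simp only: avg_tuples_Suc)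
  \<comment> \<open>Triangle inequality through the list in which \<open>h\<close> is already
    replaced by \<open>h'\<close> but \<open>bs\<close> is kept.\<close>
  also have "\<dots> \<le> avg (L i) (\<lambda>as. avg W (\<lambda>h. avg (L j) (\<lambda>bs. avg W (\<lambda>h'. avg (L j) (\<lambda>bs'.
        of_bool (?D (as @ h # bs) \<noteq> ?D (as @ h' # bs))
      + of_bool (?D (as @ h' # bs) \<noteq> ?D (as @ h' # bs')))))))"
    by (intro avg_mono of_bool_le_add) metis
  also have "\<dots> = avg (L i) (\<lambda>as. avg W (\<lambda>h. avg (L j) (\<lambda>bs. avg W (\<lambda>h'.
        of_bool (?D (as @ h # bs) \<noteq> ?D (as @ h' # bs))))))
      + avg (L i) (\<lambda>as. avg (L j) (\<lambda>bs. avg W (\<lambda>h'. avg (L j) (\<lambda>bs'.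
        of_bool (?D (as @ h' # bs) \<noteq> ?D (as @ h' # bs'))))))"
    by (simp only: avg_add avg_const_L avg_const_W)
  also have "avg (L i) (\<lambda>as. avg W (\<lambda>h. avg (L j) (\<lambda>bs. avg W (\<lambda>h'.
        of_bool (?D (as @ h # bs) \<noteq> ?D (as @ h' # bs))))))
    = avg W (\<lambda>h. avg (L i) (\<lambda>as. avg W (\<lambda>h'. avg (L j) (\<lambda>bs.
        of_bool (?D (as @ h # bs) \<noteq> ?D (as @ h' # bs))))))"
    by (simp only: avg_swap[where A = "L i" and B = W] avg_swap[where A = "L j" and B = W])
  also have "\<dots> = rejection (i + Suc j) f"
    by (rule rejection_insert[OF assms])
  \<comment> \<open>The common direction \<open>h'\<close> joins the shared prefix
    \<open>as\<close>, ready for the induction hypothesis at \<open>Suc i\<close>.\<close>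
  also have "avg (L i) (\<lambda>as. avg (L j) (\<lambda>bs. avg W (\<lambda>h'. avg (L j) (\<lambda>bs'.
        of_bool (?D (as @ h' # bs) \<noteq> ?D (as @ h' # bs'))))))
    = avg (L (Suc i)) (\<lambda>as. avg (L j) (\<lambda>bs. avg (L j) (\<lambda>bs'. of_bool (?D (as @ bs) \<noteq> ?D (as @ bs')))))"
    by (simp add: avg_snoc avg_swap[where A = "L j" and B = W])
  also have "\<dots> \<le> real j * rejection (Suc i + j) f"
    by (rule Suc)
  finally show ?case by (simp add: algebra_simps)
qed

section \<open>Self-correction by majority vote\<close>

text \<open>The vote of \<open>hs\<close> is the value at \<open>x\<close> that would make the sum
  over the flat vanish, namely the sum over its other points. A tie gives 0.\<close>

definition correction :: "nat \<Rightarrow> ('v \<Rightarrow> bit) \<Rightarrow> 'v \<Rightarrow> bit" where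
  "correction k f x = of_bool (avg (L k) (\<lambda>hs. of_bool (iter_diff hs f x + f x = 1)) > 1/2)"

text \<open>With \<open>a\<close> the share of the votes for 1, two votes disagree with probability
  \<open>2 * a * (1 - a)\<close>, which the hybrid argument bounds. The minority share is at most
  this, since the majority share is at least 1/2. Where \<open>f\<close> differs from the majority,
  at least half of the votes differ from \<open>f x\<close>, and their flats have nonzero
  sum.\<close>

lemma correction_vote:
  assumes "x \<in> W"
  shows "avg (L k) (\<lambda>hs. of_bool (iter_diff hs f x + f x \<noteq> correction k f x)) \<le> real k * rejection k f"
    (is "?p \<le> _")
    and "f x \<noteq> correction k f x \<Longrightarrow> avg (L k) (\<lambda>hs. of_bool (iter_diff hs f x \<noteq> 0)) \<ge> 1/2"
proof -
  define a where "a = avg (L k) (\<lambda>hs. of_bool (iter_diff hs f x + f x = 1))"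
  have a: "0 \<le> a" "a \<le> 1" unfolding a_def by (rule avg_of_bool_range; simp)+
  have na: "avg (L k) (\<lambda>hs. of_bool (iter_diff hs f x + f x = 0)) = 1 - a"
    unfolding a_def by (subst avg_of_bool_not[symmetric]) simp_all
  have "2 * a * (1 - a) = avg (L k) (\<lambda>hs. avg (L k) (\<lambda>hs'.
      of_bool ((iter_diff hs f x + f x = 1) \<noteq> (iter_diff hs' f x + f x = 1))))"
    unfolding a_def by (rule avg_neq[symmetric]) simp_all
  also have "\<dots> \<le> avg (L k) (\<lambda>hs. avg (L k) (\<lambda>hs'. of_bool (iter_diff hs f x \<noteq> iter_diff hs' f x)))"
    by (intro avg_mono) auto
  also have "\<dots> \<le> real k * rejection k f"
    using rejection_hybrid[OF assms, of 0 k f] by simp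
  finally have *: "2 * a * (1 - a) \<le> real k * rejection k f" .
  show "?p \<le> real k * rejection k f"
  proof (cases "a > 1/2")
    case True
    then have "?p = 1 - a" using na by (simp add: correction_def a_def)
    moreover have "1 - a \<le> 2 * a * (1 - a)"
      using True a mult_right_mono[of 1 "2 * a" "1 - a"] by simp
    ultimately show ?thesis using * by simp
  next
    case False
    then have "?p = a" by (simp add: correction_def a_def)
    moreover have "a \<le> 2 * a * (1 - a)"
      using False a mult_left_mono[of 1 "2 * (1 - a)" a] by (simp add: algebra_simps)
    ultimately show ?thesis using * by simp
  qed
  show "avg (L k) (\<lambda>hs. of_bool (iter_diff hs f x \<noteq> 0)) \<ge> 1/2" if "f x \<noteq> correction k f x"
  proof (cases "a > 1/2")
    case True
    then have "f x = 0" using that by (simp add: correction_def a_def)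
    then show ?thesis using True by (simp add: a_def)
  next
    case False
    then have "f x = 1" using that by (simp add: correction_def a_def)
    then have "iter_diff hs f x + f x = 0 \<longleftrightarrow> iter_diff hs f x \<noteq> 0" for hs
      by (cases "iter_diff hs f x") simp_all
    then show ?thesis using False na by simp
  qed
qed

text \<open>Markov's inequality: at each point where \<open>f\<close> is corrected, at least half of
  the flats have nonzero sum.\<close>

lemma correction_dist: "avg W (\<lambda>x. of_bool (f x \<noteq> correction k f x)) \<le> 2 * rejection k f"
proof -
  have "avg W (\<lambda>x. of_bool (f x \<noteq> correction k f x))
    \<le> avg W (\<lambda>x. 2 * avg (L k) (\<lambda>hs. of_bool (iter_diff hs f x \<noteq> 0)))"
  proof (rule avg_mono)
    fix x assume "x \<in> W"
    then show "of_bool (f x \<noteq> correction k f x) \<le> 2 * avg (L k) (\<lambda>hs. of_bool (iter_diff hs f x \<noteq> 0))"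
      using correction_vote(2)[of x f k] avg_of_bool_range(1)[of "L k" "\<lambda>hs. iter_diff hs f x \<noteq> 0"]
      by (cases "f x \<noteq> correction k f x") auto
  qed
  then show ?thesis by (simp only: avg_cmult rejection_def)
qed

text \<open>Adding \<open>e x\<close> removes the base point from the flat. Each of the other
  \<open>2 ^ k - 1\<close> points is uniform for random directions and fixed \<open>x\<close>, so
  this is a union bound, done one direction at a time.\<close>

lemma iter_diff_sparse:
  assumes "x \<in> W"
  shows "avg (L k) (\<lambda>hs. of_bool (iter_diff hs e x + e x \<noteq> 0))
    \<le> (2 ^ k - 1) * avg W (\<lambda>x. of_bool (e x \<noteq> 0))"
  using assms
proof (induction k arbitrary: x)
  case 0
  then show ?case by simp
next
  case (Suc k)
  let ?\<mu> = "avg W (\<lambda>x. of_bool (e x \<noteq> 0))"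
  have "avg (L (Suc k)) (\<lambda>hs. of_bool (iter_diff hs e x + e x \<noteq> 0))
    \<le> avg W (\<lambda>h. avg (L k) (\<lambda>hs. of_bool (iter_diff hs e x + e x \<noteq> 0)
        + (of_bool (iter_diff hs e (x + h) + e (x + h) \<noteq> 0) + of_bool (e (x + h) \<noteq> 0))))"
    unfolding avg_tuples_Suc
  proof (intro avg_mono)
    fix h hs
    show "of_bool (iter_diff (h # hs) e x + e x \<noteq> 0) \<le> of_bool (iter_diff hs e x + e x \<noteq> 0)
        + (of_bool (iter_diff hs e (x + h) + e (x + h) \<noteq> 0) + (of_bool (e (x + h) \<noteq> 0) :: real))"
      by (cases "iter_diff hs e x"; cases "iter_diff hs e (x + h)"; cases "e x"; cases "e (x + h)") simp_all
  qed
  also have "\<dots> = avg (L k) (\<lambda>hs. of_bool (iter_diff hs e x + e x \<noteq> 0))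
     + (avg W (\<lambda>h. avg (L k) (\<lambda>hs. of_bool (iter_diff hs e (x + h) + e (x + h) \<noteq> 0)))
        + avg W (\<lambda>h. of_bool (e (x + h) \<noteq> 0)))"
    by (simp only: avg_add avg_const_L avg_const_W)
  also have "avg W (\<lambda>h. of_bool (e (x + h) \<noteq> 0)) = ?\<mu>"
    by (rule avg_translate'[OF Suc.prems, of "\<lambda>y. of_bool (e y \<noteq> 0)"])
  also have "avg W (\<lambda>h. avg (L k) (\<lambda>hs. of_bool (iter_diff hs e (x + h) + e (x + h) \<noteq> 0)))
      \<le> (2 ^ k - 1) * ?\<mu>"
    by (intro avg_le_const Suc) (auto simp: Suc.prems)
  also have "avg (L k) (\<lambda>hs. of_bool (iter_diff hs e x + e x \<noteq> 0)) \<le> (2 ^ k - 1) * ?\<mu>"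
    by (intro Suc)
  finally show ?case by (simp add: algebra_simps)
qed

text \<open>The corrected function is \<open>f + e\<close> with \<open>e\<close> of density at most
  twice the rejection probability. If the sum of \<open>e\<close> over the points other than
  \<open>x\<close> vanishes and the vote of \<open>hs\<close> agrees with the majority, then the
  difference of the correction at \<open>x\<close> is 0.\<close>

lemma correction_iter_diff_random:
  assumes "x \<in> W"
  shows "avg (L k) (\<lambda>hs. of_bool (iter_diff hs (correction k f) x \<noteq> 0))
    \<le> (real k + 2 * 2 ^ k) * rejection k f"
proof -
  let ?g = "correction k f"
  define e where "e = (\<lambda>x. f x + ?g x)"
  have e0: "e y \<noteq> 0 \<longleftrightarrow> f y \<noteq> ?g y" for y
    unfolding e_def by (simp only: bit_add_eq_0)
  have "avg (L k) (\<lambda>hs. of_bool (iter_diff hs ?g x \<noteq> 0))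
    \<le> avg (L k) (\<lambda>hs. of_bool (iter_diff hs e x + e x \<noteq> 0)
         + of_bool (iter_diff hs f x + f x \<noteq> ?g x))"
  proof (intro avg_mono of_bool_le_add)
    fix hs assume *: "iter_diff hs ?g x \<noteq> 0"
    have "iter_diff hs e x = iter_diff hs f x + iter_diff hs ?g x"
      unfolding e_def by (rule iter_diff_add)
    then show "iter_diff hs e x + e x \<noteq> 0 \<or> iter_diff hs f x + f x \<noteq> ?g x"
      using * unfolding e_def
      by (cases "iter_diff hs f x"; cases "iter_diff hs ?g x"; cases "f x"; cases "?g x") simp_all
  qed
  also have "\<dots> \<le> (2 ^ k - 1) * avg W (\<lambda>x. of_bool (e x \<noteq> 0)) + real k * rejection k f"
    unfolding avg_add by (intro add_mono iter_diff_sparse correction_vote assms)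
  also have "\<dots> \<le> 2 ^ k * (2 * rejection k f) + real k * rejection k f"
    unfolding e0 by (intro add_mono mult_mono correction_dist avg_nonneg) (auto simp: rejection_nonneg)
  finally show ?thesis by (simp add: algebra_simps)
qed

text \<open>A fixed direction \<open>h\<close> is traded for the two uniformly random directions \<open>u\<close> and \<open>h + u\<close>.\<close>

lemma iter_diff_fix_directions:
  assumes "\<And>x. x \<in> W \<Longrightarrow> avg (L k) (\<lambda>hs. of_bool (iter_diff hs g x \<noteq> 0)) \<le> \<eta>"
  shows "as \<in> L j \<Longrightarrow> j + l = k \<Longrightarrow> x \<in> W \<Longrightarrow>
    avg (L l) (\<lambda>bs. of_bool (iter_diff (as @ bs) g x \<noteq> 0)) \<le> 2 ^ j * \<eta>"
proof (induction j arbitrary: as l x)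
  case 0
  then show ?case using assms by simp
next
  case (Suc j)
  obtain cs h where as: "as = cs @ [h]" "cs \<in> L j" "h \<in> W"
    using Suc.prems(1) by (cases as rule: rev_cases) (auto simp: tuples_W)
  have "avg (L l) (\<lambda>bs. of_bool (iter_diff (as @ bs) g x \<noteq> 0))
    = avg W (\<lambda>u. avg (L l) (\<lambda>bs. of_bool (iter_diff (as @ bs) g x \<noteq> 0)))" by simp
  also have "\<dots> \<le> avg W (\<lambda>u. avg (L l) (\<lambda>bs. of_bool (iter_diff (cs @ u # bs) g x \<noteq> 0)
      + of_bool (iter_diff (cs @ (h + u) # bs) g (x + h) \<noteq> 0)))"
  proof (intro avg_mono of_bool_le_add)
    fix u bs assume u: "u \<in> W" and *: "iter_diff (as @ bs) g x \<noteq> 0"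
    have eq: "x + h + (h + u) = x + u"
      using add_self2[of h] as by (metis add.assoc)
    have "iter_diff (as @ bs) g x
      = iter_diff (cs @ u # bs) g x + iter_diff (cs @ (h + u) # bs) g (x + h)"
      unfolding as append.assoc append.simps iter_diff_insert eq by (simp add: ac_simps)
    then show "iter_diff (cs @ u # bs) g x \<noteq> 0 \<or> iter_diff (cs @ (h + u) # bs) g (x + h) \<noteq> 0"
      using * by auto
  qed
  also have "\<dots> = avg W (\<lambda>u. avg (L l) (\<lambda>bs. of_bool (iter_diff (cs @ u # bs) g x \<noteq> 0)))
     + avg W (\<lambda>u. avg (L l) (\<lambda>bs. of_bool (iter_diff (cs @ (h + u) # bs) g (x + h) \<noteq> 0)))"
    by (simp only: avg_add)
  also have "avg W (\<lambda>u. avg (L l) (\<lambda>bs. of_bool (iter_diff (cs @ (h + u) # bs) g (x + h) \<noteq> 0)))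
     = avg W (\<lambda>u. avg (L l) (\<lambda>bs. of_bool (iter_diff (cs @ u # bs) g (x + h) \<noteq> 0)))"
    by (rule avg_translate'[OF as(3), of "\<lambda>u. avg (L l) (\<lambda>bs. of_bool (iter_diff (cs @ u # bs) g (x + h) \<noteq> 0))"])
  also have "\<dots> = avg (L (Suc l)) (\<lambda>bs. of_bool (iter_diff (cs @ bs) g (x + h) \<noteq> 0))"
    by (simp only: avg_tuples_Suc)
  also have "\<dots> \<le> 2 ^ j * \<eta>"
    using Suc.prems as by (intro Suc.IH) auto
  also have "avg W (\<lambda>u. avg (L l) (\<lambda>bs. of_bool (iter_diff (cs @ u # bs) g x \<noteq> 0)))
    = avg (L (Suc l)) (\<lambda>bs. of_bool (iter_diff (cs @ bs) g x \<noteq> 0))"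
    by (simp only: avg_tuples_Suc)
  also have "\<dots> \<le> 2 ^ j * \<eta>"
    using Suc.prems as by (intro Suc.IH) auto
  finally show ?case by (simp add: mult_ac)
qed

text \<open>Once all \<open>k\<close> directions are fixed nothing is random, so a probability below
  1 must be 0. The bound comes from \<open>2 ^ k * (k + 2 * 2 ^ k) \<le> 3 * 4 ^ k\<close>.\<close>

lemma correction_iter_diff_zero:
  assumes "3 * 4 ^ k * rejection k f < 1" "hs \<in> L k" "x \<in> W"
  shows "iter_diff hs (correction k f) x = 0"
proof (rule ccontr)
  assume *: "iter_diff hs (correction k f) x \<noteq> 0"
  note r = rejection_nonneg[of k f]
  have "(1::real) = avg (L 0) (\<lambda>bs. of_bool (iter_diff (hs @ bs) (correction k f) x \<noteq> 0))"
    using * by simp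
  also have "\<dots> \<le> 2 ^ k * ((real k + 2 * 2 ^ k) * rejection k f)"
    by (rule iter_diff_fix_directions[OF correction_iter_diff_random assms(2) _ assms(3)]) simp_all
  also have "\<dots> \<le> 2 ^ k * ((2 ^ k + 2 * 2 ^ k) * rejection k f)"
    using r of_nat_less_two_power[of k, where 'a = real]
    by (intro mult_left_mono mult_right_mono add_right_mono) simp_all
  also have "\<dots> = 3 * 4 ^ k * rejection k f"
    using power_mult_distrib[of "2::real" 2 k] by (simp add: algebra_simps)
  finally show False using assms(1) by simp
qed

end

text \<open>Bernoulli gives \<open>1 + r * x \<le> (1 + x) ^ r\<close>, and
  \<open>(1 - x) * (1 + x) \<le> 1\<close>.\<close>

lemma power_one_minus_mult_le:
  assumes "0 \<le> x" "x \<le> (1::real)"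
  shows "(1 - x) ^ r * (1 + real r * x) \<le> 1"
proof -
  have "(1 - x) ^ r * (1 + real r * x) \<le> (1 - x) ^ r * (1 + x) ^ r"
    using assms Bernoulli_inequality[of x r] by (intro mult_left_mono) auto
  also have "\<dots> = (1 - x\<^sup>2) ^ r"
    by (simp add: power_mult_distrib[symmetric] algebra_simps power2_eq_square)
  also have "\<dots> \<le> 1"
    using assms by (intro power_le_one) (auto simp: abs_square_le_1 power_le_one)
  finally show ?thesis .
qed

lemma one_minus_power_ge:
  assumes "0 \<le> x" "x \<le> (1::real)"
  shows "1 - (1 - x) ^ r \<ge> min 1 (real r * x) / 2"
proof -
  let ?y = "real r * x"
  have y: "0 \<le> ?y" using assms by simp
  have "(1 - x) ^ r \<le> 1 / (1 + ?y)"
    using y power_one_minus_mult_le[OF assms, of r] by (simp add: field_simps)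
  then have "?y / (1 + ?y) \<le> 1 - (1 - x) ^ r"
    using y by (simp add: field_simps)
  moreover have "min 1 ?y / 2 \<le> ?y / (1 + ?y)"
    using y mult_left_mono[of ?y 1 ?y] by (auto simp: min_def field_simps)
  ultimately show ?thesis by linarith
qed

section \<open>Sum tests and their rejection probability\<close>

context boolean_group
begin

text \<open>Generalised linearity test on \<open>s\<close> uniform points. For odd \<open>s\<close>
  every affine function passes it.\<close>

definition sum_rejection :: "nat \<Rightarrow> ('v \<Rightarrow> bit) \<Rightarrow> real" where
  "sum_rejection s F = avg (L s) (\<lambda>ys. of_bool (F (sum_list ys) \<noteq> sum_list (map F ys)))"

lemma sum_list_W: "set xs \<subseteq> W \<Longrightarrow> sum_list xs \<in> W"
  by (induction xs) auto

text \<open>Two sum tests that share all but two points and have the same total sum yield a test on four points.\<close>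

lemma four_point_le_sum_rejection:
  "avg W (\<lambda>x. avg W (\<lambda>a. avg W (\<lambda>b. of_bool (F x + F a + F b + F (x + a + b) \<noteq> 0))))
    \<le> 2 * sum_rejection (Suc (Suc r)) F"
proof -
  define T where "T ys \<longleftrightarrow> F (sum_list ys) \<noteq> sum_list (map F ys)" for ys
  have "avg W (\<lambda>x. avg W (\<lambda>a. avg W (\<lambda>b. of_bool (F x + F a + F b + F (x + a + b) \<noteq> 0))))
     = avg W (\<lambda>x. avg W (\<lambda>a. avg W (\<lambda>b. avg (L r) (\<lambda>ys. of_bool (F x + F a + F b + F (x + a + b) \<noteq> 0)))))"
    by simp
  also have "\<dots> \<le> avg W (\<lambda>x. avg W (\<lambda>a. avg W (\<lambda>b. avg (L r) (\<lambda>ys.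
      of_bool (T (x # a # ys)) + of_bool (T (b # (x + a + b) # ys))))))"
  proof (intro avg_mono of_bool_le_add, rule ccontr)
    fix x a b ys assume W: "x \<in> W" "a \<in> W" "b \<in> W" and *: "F x + F a + F b + F (x + a + b) \<noteq> 0"
      and "\<not> (T (x # a # ys) \<or> T (b # (x + a + b) # ys))"
    then have "F (x + (a + sum_list ys)) = F x + (F a + sum_list (map F ys))"
      "F (b + (x + a + b + sum_list ys)) = F b + (F (x + a + b) + sum_list (map F ys))"
      unfolding T_def by simp_all
    moreover have "b + (x + a + b + sum_list ys) = x + (a + sum_list ys)"
      using add_self2(1)[OF W(3), of "x + (a + sum_list ys)"] by (simp only: ac_simps)
    ultimately have "F x + (F a + sum_list (map F ys)) = F b + (F (x + a + b) + sum_list (map F ys))"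
      by metis
    then show False
      using * by (cases "F x"; cases "F a"; cases "F b"; cases "F (x + a + b)"; cases "sum_list (map F ys)") simp_all
  qed
  also have "\<dots> = avg W (\<lambda>x. avg W (\<lambda>a. avg (L r) (\<lambda>ys. of_bool (T (x # a # ys)))))
     + avg W (\<lambda>x. avg W (\<lambda>a. avg W (\<lambda>b. avg (L r) (\<lambda>ys. of_bool (T (b # (x + a + b) # ys))))))"
    by (simp only: avg_add avg_const_W)
  also have "avg W (\<lambda>x. avg W (\<lambda>a. avg (L r) (\<lambda>ys. of_bool (T (x # a # ys))))) = sum_rejection (Suc (Suc r)) F"
    by (simp only: sum_rejection_def avg_tuples_Suc T_def)
  also have "avg W (\<lambda>x. avg W (\<lambda>a. avg W (\<lambda>b. avg (L r) (\<lambda>ys. of_bool (T (b # (x + a + b) # ys))))))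
     = avg W (\<lambda>x. avg W (\<lambda>b. avg W (\<lambda>a. avg (L r) (\<lambda>ys. of_bool (T (b # a # ys))))))"
  proof (rule avg_cong)
    fix x assume x: "x \<in> W"
    have "avg W (\<lambda>a. avg W (\<lambda>b. avg (L r) (\<lambda>ys. of_bool (T (b # (x + a + b) # ys)))))
      = avg W (\<lambda>b. avg W (\<lambda>a. avg (L r) (\<lambda>ys. of_bool (T (b # (a + (x + b)) # ys)))))"
      by (subst avg_swap) (simp only: ac_simps)
    also have "\<dots> = avg W (\<lambda>b. avg W (\<lambda>a. avg (L r) (\<lambda>ys. of_bool (T (b # a # ys)))))"
      by (rule avg_cong, rule avg_translate[where \<phi> = "\<lambda>a. avg (L r) (\<lambda>ys. of_bool (T (_ # a # ys)))"])
        (use x in simp)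
    finally show "avg W (\<lambda>a. avg W (\<lambda>b. avg (L r) (\<lambda>ys. of_bool (T (b # (x + a + b) # ys)))))
      = avg W (\<lambda>b. avg W (\<lambda>a. avg (L r) (\<lambda>ys. of_bool (T (b # a # ys)))))" .
  qed
  also have "\<dots> = sum_rejection (Suc (Suc r)) F"
    by (simp add: sum_rejection_def avg_tuples_Suc T_def)
  finally show ?thesis by simp
qed

text \<open>Two directions \<open>a\<close>, \<open>b\<close> are split off, which leaves the points
  \<open>x\<close>, \<open>x + a\<close>, \<open>x + b\<close>, \<open>x + a + b\<close>. When the
  middle two are renamed to \<open>a\<close> and \<open>b\<close>, the fourth is again
  \<open>x + a + b\<close>, since \<open>x + x = 0\<close>.\<close>

lemma rejection_eq_four_point:
  "rejection (Suc (Suc k)) f = avg (L k) (\<lambda>hs. avg W (\<lambda>x. avg W (\<lambda>a. avg W (\<lambda>b.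
     of_bool (iter_diff hs f x + iter_diff hs f a + iter_diff hs f b + iter_diff hs f (x + a + b) \<noteq> 0)))))"
proof -
  define G where "G x a b = avg (L k) (\<lambda>hs. of_bool (iter_diff hs f x + iter_diff hs f a
     + iter_diff hs f b + iter_diff hs f (a + b + x) \<noteq> 0))" for x a b
  have "rejection (Suc (Suc k)) f = avg W (\<lambda>x. avg W (\<lambda>a. avg W (\<lambda>b. avg (L k) (\<lambda>hs.
      of_bool (iter_diff (a # b # hs) f x \<noteq> 0)))))"
    by (simp only: rejection_def avg_tuples_Suc)
  also have "\<dots> = avg W (\<lambda>x. avg W (\<lambda>a. avg W (\<lambda>b. G x (x + a) (x + b))))"
  proof (intro avg_cong)
    fix x a b assume "x \<in> W"
    then have "x + a + (x + b) + x = x + a + b"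
      using add_self2(1)[of x "a + b + x"] by (simp only: ac_simps)
    then show "avg (L k) (\<lambda>hs. of_bool (iter_diff (a # b # hs) f x \<noteq> 0)) = G x (x + a) (x + b)"
      unfolding G_def by (simp add: ac_simps)
  qed
  also have "\<dots> = avg W (\<lambda>x. avg W (\<lambda>a. avg W (\<lambda>b. G x a b)))"
  proof (rule avg_cong)
    fix x assume x: "x \<in> W"
    have "avg W (\<lambda>a. avg W (\<lambda>b. G x (x + a) (x + b))) = avg W (\<lambda>a. avg W (\<lambda>b. G x (x + a) b))"
      by (intro avg_cong avg_translate' x)
    also have "\<dots> = avg W (\<lambda>a. avg W (\<lambda>b. G x a b))"
      by (rule avg_translate'[OF x, of "\<lambda>a. avg W (\<lambda>b. G x a b)"])
    finally show "avg W (\<lambda>a. avg W (\<lambda>b. G x (x + a) (x + b))) = avg W (\<lambda>a. avg W (\<lambda>b. G x a b))" .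
  qed
  also have "\<dots> = avg W (\<lambda>x. avg W (\<lambda>a. avg W (\<lambda>b. avg (L k) (\<lambda>hs. of_bool (iter_diff hs f x + iter_diff hs f a
     + iter_diff hs f b + iter_diff hs f (x + a + b) \<noteq> 0)))))"
    unfolding G_def by (simp only: ac_simps)
  also have "\<dots> = avg (L k) (\<lambda>hs. avg W (\<lambda>x. avg W (\<lambda>a. avg W (\<lambda>b.
     of_bool (iter_diff hs f x + iter_diff hs f a + iter_diff hs f b + iter_diff hs f (x + a + b) \<noteq> 0)))))"
    by (simp only: avg_swap[where A = W and B = "L k"])
  finally show ?thesis .
qed

lemma rejection_le_sum_rejection:
  "rejection (Suc (Suc k)) f \<le> 2 * avg (L k) (\<lambda>hs. sum_rejection (Suc (Suc r)) (iter_diff hs f))"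
  unfolding rejection_eq_four_point avg_cmult[symmetric]
  by (intro avg_mono four_point_le_sum_rejection)

text \<open>The points \<open>a\<close>, \<open>b\<close>, \<open>s\<close> and
  \<open>a + b + s\<close>, with \<open>s\<close> the sum of the remaining points, form a flat at
  \<open>a\<close> with directions \<open>a + b\<close> and \<open>a + s\<close>. This removes two
  summands at a time and ends with a single one.\<close>

lemma affine_sum_list:
  assumes "\<And>x a b. x \<in> W \<Longrightarrow> a \<in> W \<Longrightarrow> b \<in> W \<Longrightarrow> iter_diff [a, b] F x = 0"
  shows "set ys \<subseteq> W \<Longrightarrow> odd (length ys) \<Longrightarrow> F (sum_list ys) = sum_list (map F ys)"
proof (induction ys rule: induct_list012)
  case (3 a b ys)
  show ?case
  proof -
    let ?s = "sum_list ys"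
    have W: "a \<in> W" "b \<in> W" "?s \<in> W" using 3 sum_list_W by auto
    then have "F a + F (a + (a + ?s)) + (F (a + (a + b)) + F (a + (a + b) + (a + ?s))) = 0"
      using assms[of a "a + b" "a + ?s"] by simp
    then have "F a + F ?s + (F b + F (a + (b + ?s))) = 0"
      using W by (simp add: add.left_commute)
    then have "F (a + (b + ?s)) = F a + (F b + F ?s)"
      by (cases "F a"; cases "F ?s"; cases "F b"; cases "F (a + (b + ?s))") simp_all
    then show ?thesis using 3 by simp
  qed
qed auto

text \<open>Piling-up lemma: the bias \<open>1 - 2 * \<beta>\<close> of one sample, where \<beta> is
  the density of the support of \<open>G\<close>, multiplies over independent samples.\<close>

lemma odd_parity:
  fixes G :: "'v \<Rightarrow> bit"
  shows "avg (L r) (\<lambda>ys. of_bool (sum_list (map G ys) \<noteq> 0)) = (1 - (1 - 2 * avg W (\<lambda>x. of_bool (G x \<noteq> 0))) ^ r) / 2"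
proof (induction r)
  case 0
  then show ?case by simp
next
  case (Suc r)
  let ?\<beta> = "avg W (\<lambda>x. of_bool (G x \<noteq> 0))"
  have "avg (L (Suc r)) (\<lambda>ys. of_bool (sum_list (map G ys) \<noteq> 0))
    = avg W (\<lambda>y. avg (L r) (\<lambda>ys. of_bool (G y \<noteq> 0) + of_bool (sum_list (map G ys) \<noteq> 0)
        - 2 * (of_bool (G y \<noteq> 0) * of_bool (sum_list (map G ys) \<noteq> 0))))"
    unfolding avg_tuples_Suc
  proof (intro avg_cong)
    fix y ys
    show "of_bool (sum_list (map G (y # ys)) \<noteq> 0) = of_bool (G y \<noteq> 0) + of_bool (sum_list (map G ys) \<noteq> 0)
        - 2 * (of_bool (G y \<noteq> 0) * (of_bool (sum_list (map G ys) \<noteq> 0) :: real))"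
      by (cases "G y"; cases "sum_list (map G ys)") simp_all
  qed
  also have "\<dots> = ?\<beta> + (1 - (1 - 2 * ?\<beta>) ^ r) / 2 - 2 * (?\<beta> * ((1 - (1 - 2 * ?\<beta>) ^ r) / 2))"
    by (simp only: avg_diff avg_add avg_cmult avg_multc avg_const_W avg_const_L Suc)
  also have "\<dots> = (1 - (1 - 2 * ?\<beta>) ^ Suc r) / 2"
    by (simp add: field_simps)
  finally show ?case .
qed

text \<open>With probability at least \<open>1 - 2\<beta>\<close> neither the first summand nor the total sum lies in
  the support of \<open>G\<close>, and then the parity of the remaining, independent summands decides.\<close>

lemma sum_rejection_sparse:
  assumes "\<And>x a b. x \<in> W \<Longrightarrow> a \<in> W \<Longrightarrow> b \<in> W \<Longrightarrow> iter_diff [a, b] p x = 0"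
    and "\<And>x. x \<in> W \<Longrightarrow> F x = p x + G x" and "even r"
  defines "\<beta> \<equiv> avg W (\<lambda>x. of_bool (G x \<noteq> 0))"
  shows "sum_rejection (Suc r) F \<ge> (1 - 2 * \<beta>) * ((1 - (1 - 2 * \<beta>) ^ r) / 2)"
proof -
  \<comment> \<open>The number \<open>Suc r\<close> of points is odd, so the affine part
    \<open>p\<close> cancels and \<open>F\<close> may be replaced by \<open>G\<close>.\<close>
  have F: "F (sum_list ys) \<noteq> sum_list (map F ys) \<longleftrightarrow> G (sum_list ys) \<noteq> sum_list (map G ys)"
    if "set ys \<subseteq> W" "length ys = Suc r" for ys
  proof -
    have "sum_list (map F ys) = sum_list (map p ys) + sum_list (map G ys)"
      using that(1) by (induction ys) (auto simp: assms(2) ac_simps)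
    moreover have "F (sum_list ys) = sum_list (map p ys) + G (sum_list ys)"
      using that assms(3) by (simp add: assms(2) sum_list_W affine_sum_list[OF assms(1)])
    ultimately show ?thesis by simp
  qed
  have "(1 - 2 * \<beta>) * ((1 - (1 - 2 * \<beta>) ^ r) / 2)
     = avg (L r) (\<lambda>ys. of_bool (sum_list (map G ys) \<noteq> 0) * (1 - 2 * \<beta>))"
    by (simp only: avg_multc odd_parity \<beta>_def mult.commute)
  also have "\<dots> \<le> avg (L r) (\<lambda>ys. avg W (\<lambda>y. of_bool (F (sum_list (y # ys)) \<noteq> sum_list (map F (y # ys)))))"
  proof (rule avg_mono)
    fix ys assume ys: "ys \<in> L r"
    let ?s = "sum_list ys"
    have s: "?s \<in> W" using ys sum_list_W by (auto simp: tuples_W)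
    show "of_bool (sum_list (map G ys) \<noteq> 0) * (1 - 2 * \<beta>)
       \<le> avg W (\<lambda>y. of_bool (F (sum_list (y # ys)) \<noteq> sum_list (map F (y # ys))))"
    proof (cases "sum_list (map G ys) = 0")
      case True
      then show ?thesis by (simp add: avg_nonneg)
    next
      case False
      have "1 - 2 * \<beta> = avg W (\<lambda>y. 1 - (of_bool (G y \<noteq> 0) + of_bool (G (y + ?s) \<noteq> 0)))"
        using avg_translate[OF s, of "\<lambda>y. of_bool (G y \<noteq> 0)"]
        by (simp only: avg_diff avg_add avg_const_W \<beta>_def)
      also have "\<dots> \<le> avg W (\<lambda>y. of_bool (G (sum_list (y # ys)) \<noteq> sum_list (map G (y # ys))))"
        using False by (intro avg_mono) (auto split: bit.splits simp: of_bool_def)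
      also have "\<dots> = avg W (\<lambda>y. of_bool (F (sum_list (y # ys)) \<noteq> sum_list (map F (y # ys))))"
      proof (rule avg_cong)
        fix y assume "y \<in> W"
        then have "y # ys \<in> L (Suc r)" using ys by simp
        then show "of_bool (G (sum_list (y # ys)) \<noteq> sum_list (map G (y # ys)))
          = (of_bool (F (sum_list (y # ys)) \<noteq> sum_list (map F (y # ys))) :: real)"
          unfolding tuples_W using F[of "y # ys"] by (simp only: simp_thms)
      qed
      finally show ?thesis using False by simp
    qed
  qed
  also have "\<dots> = sum_rejection (Suc r) F"
    unfolding sum_rejection_def avg_tuples_Suc by (rule avg_swap)
  finally show ?thesis .
qed

section \<open>Support of the differences of a sparse function\<close>

text \<open>The support of the difference is covered by \<open>2 ^ length hs\<close> translates of
  the support of \<open>e\<close>.\<close>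

lemma support_iter_diff_upper:
  "set hs \<subseteq> W \<Longrightarrow> avg W (\<lambda>x. of_bool (iter_diff hs e x \<noteq> 0)) \<le> 2 ^ length hs * avg W (\<lambda>x. of_bool (e x \<noteq> 0))"
proof (induction hs)
  case (Cons h hs)
  have "avg W (\<lambda>x. of_bool (iter_diff (h # hs) e x \<noteq> 0))
    \<le> avg W (\<lambda>x. of_bool (iter_diff hs e x \<noteq> 0) + of_bool (iter_diff hs e (x + h) \<noteq> 0))"
    by (intro avg_mono of_bool_le_add) auto
  also have "\<dots> = 2 * avg W (\<lambda>x. of_bool (iter_diff hs e x \<noteq> 0))"
    using Cons.prems avg_translate[of h "\<lambda>x. of_bool (iter_diff hs e x \<noteq> 0)"] by (simp add: avg_add)
  also have "\<dots> \<le> 2 ^ length (h # hs) * avg W (\<lambda>x. of_bool (e x \<noteq> 0))"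
    using Cons by simp
  finally show ?case .
qed simp

text \<open>For a further random direction \<open>h\<close> the points \<open>x\<close> and
  \<open>x + h\<close> are independent, so a density \<open>b\<close> becomes
  \<open>2 * b * (1 - b)\<close> on average. As \<open>b\<close> is at most
  \<open>2 ^ k * \<mu>\<close>, the density nearly doubles each time.\<close>

lemma support_iter_diff_lower:
  fixes e :: "'v \<Rightarrow> bit"
  defines "\<mu> \<equiv> avg W (\<lambda>x. of_bool (e x \<noteq> 0))"
  assumes "2 ^ k * \<mu> \<le> 1"
  shows "avg (L k) (\<lambda>hs. avg W (\<lambda>x. of_bool (iter_diff hs e x \<noteq> 0))) \<ge> 2 ^ k * \<mu> * (1 - 2 ^ k * \<mu>)"
  using assms(2)
proof (induction k)
  case 0
  have "0 \<le> \<mu>" unfolding \<mu>_def by (intro avg_nonneg) simp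
  then show ?case by (simp add: \<mu>_def[symmetric] algebra_simps del: bit_not_zero_iff)
next
  case (Suc k)
  let ?y = "2 ^ k * \<mu>" and ?b = "\<lambda>hs. avg W (\<lambda>x. of_bool (iter_diff hs e x \<noteq> 0))"
  have \<mu>: "0 \<le> \<mu>" unfolding \<mu>_def by (intro avg_nonneg) simp
  have y: "0 \<le> ?y" "?y \<le> 1" using Suc.prems \<mu> by auto
  have "2 ^ Suc k * \<mu> * (1 - 2 ^ Suc k * \<mu>) = 2 * (?y * (1 - 2 * ?y))"
    by simp
  \<comment> \<open>\<open>1 - 2 * y \<le> (1 - y) ^ 2\<close> is why the form
    \<open>y * (1 - y)\<close> survives the doubling of \<open>y\<close>.\<close>
  also have "\<dots> \<le> 2 * (?y * ((1 - ?y) * (1 - ?y)))"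
    using y zero_le_square[of ?y] by (intro mult_left_mono) (simp_all add: algebra_simps)
  also have "\<dots> = 2 * (1 - ?y) * (?y * (1 - ?y))"
    by simp
  also have "\<dots> \<le> 2 * (1 - ?y) * avg (L k) ?b"
    using y by (intro mult_left_mono Suc.IH) auto
  also have "\<dots> = avg (L k) (\<lambda>hs. 2 * (1 - ?y) * ?b hs)"
    by (simp only: avg_cmult)
  also have "\<dots> \<le> avg (L k) (\<lambda>hs. 2 * ?b hs * (1 - ?b hs))"
  proof (rule avg_mono)
    fix hs assume "hs \<in> L k"
    then have "?b hs \<le> ?y" using support_iter_diff_upper[of hs e] by (simp add: tuples_W \<mu>_def)
    moreover have "0 \<le> ?b hs" by (intro avg_nonneg) simp
    ultimately have "2 * ?b hs * (1 - ?y) \<le> 2 * ?b hs * (1 - ?b hs)"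
      by (intro mult_left_mono) auto
    then show "2 * (1 - ?y) * ?b hs \<le> 2 * ?b hs * (1 - ?b hs)" by (simp only: mult_ac)
  qed
  also have "\<dots> = avg (L k) (\<lambda>hs. avg W (\<lambda>x. avg W (\<lambda>y. of_bool ((iter_diff hs e x \<noteq> 0) \<noteq> (iter_diff hs e y \<noteq> 0)))))"
    by (intro avg_cong avg_neq[symmetric]) simp_all
  also have "\<dots> = avg (L k) (\<lambda>hs. avg W (\<lambda>x. avg W (\<lambda>h. of_bool ((iter_diff hs e x \<noteq> 0) \<noteq> (iter_diff hs e (x + h) \<noteq> 0)))))"
    by (intro avg_cong avg_translate'[symmetric])
  also have "\<dots> = avg (L k) (\<lambda>hs. avg W (\<lambda>h. avg W (\<lambda>x. of_bool ((iter_diff hs e x \<noteq> 0) \<noteq> (iter_diff hs e (x + h) \<noteq> 0)))))"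
    by (intro avg_cong avg_swap)
  also have "\<dots> = avg W (\<lambda>h. avg (L k) (\<lambda>hs. avg W (\<lambda>x. of_bool ((iter_diff hs e x \<noteq> 0) \<noteq> (iter_diff hs e (x + h) \<noteq> 0)))))"
    by (rule avg_swap)
  also have "\<dots> = avg (L (Suc k)) ?b"
    unfolding avg_tuples_Suc
  proof (intro avg_cong)
    fix h hs x
    show "of_bool ((iter_diff hs e x \<noteq> 0) \<noteq> (iter_diff hs e (x + h) \<noteq> 0)) = (of_bool (iter_diff (h # hs) e x \<noteq> 0) :: real)"
      by (cases "iter_diff hs e x"; cases "iter_diff hs e (x + h)") simp_all
  qed
  finally show ?case .
qed

end

section \<open>Rounds and erasures\<close>

fun sel :: "bool list \<Rightarrow> 'v list \<Rightarrow> 'v list" where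
  "sel (c # cs) (u # v # ys) = (if c then u else v) # sel cs ys"
| "sel _ _ = []"

lemma set_sel: "set (sel c ys) \<subseteq> set ys"
  by (induction c ys rule: sel.induct) auto

text \<open>\<open>er past\<close> is the erased set after the queries \<open>past\<close>. It stays
  fixed during a batch, so \<open>past\<close> grows by whole batches.\<close>

primrec hit :: "('v list \<Rightarrow> 'v set) \<Rightarrow> 'v list \<Rightarrow> 'v list list \<Rightarrow> bool" where
  "hit er past [] \<longleftrightarrow> False"
| "hit er past (B # Bs) \<longleftrightarrow> set B \<inter> er past \<noteq> {} \<or> hit er (past @ B) Bs"

lemma hit_append: "hit er past (Bs @ Cs) \<longleftrightarrow> hit er past Bs \<or> hit er (past @ concat Bs) Cs"
  by (induction Bs arbitrary: past) auto

lemma avg_bool: "avg UNIV \<phi> = 1/2 * \<phi> True + 1/2 * \<phi> False"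
  by (simp add: avg_def UNIV_bool)

text \<open>A seed consists of the directions, the points of the pairs and the coins. All points of
  the pairs are queried before the coins influence any query.\<close>

definition batches :: "'v::ab_group_add list \<times> 'v list \<times> bool list \<Rightarrow> 'v list list" where
  "batches = (\<lambda>(hs, ys, c). map (pts hs) (ys @ [sum_list (sel c ys)]))"

definition rejects :: "('v::ab_group_add \<Rightarrow> bit) \<Rightarrow> 'v list \<times> 'v list \<times> bool list \<Rightarrow> bool" where
  "rejects f = (\<lambda>(hs, ys, c).
     iter_diff hs f (sum_list (sel c ys)) \<noteq> sum_list (map (iter_diff hs f) (sel c ys)))"

text \<open>The comparison reads \<open>f\<close> at queried points only, so it can be evaluated
  from the answers.\<close>

lemma rejects_cong:
  assumes "\<And>x. x \<in> set (concat (batches \<omega>)) \<Longrightarrow> f x = g x"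
  shows "rejects f \<omega> = rejects g \<omega>"
proof -
  obtain hs ys c where \<omega>: "\<omega> = (hs, ys, c)" by (cases \<omega>)
  have "iter_diff hs f y = iter_diff hs g y" if "y \<in> insert (sum_list (sel c ys)) (set ys)" for y
    unfolding iter_diff_eq_sum_list using that assms
    by (intro arg_cong[where f = sum_list] map_cong refl) (auto simp: \<omega> batches_def)
  then show ?thesis
    using set_sel[of c ys] unfolding rejects_def \<omega>
    by (auto cong: map_cong simp: subset_iff)
qed

section \<open>Random seeds of a round\<close>

context boolean_group
begin

abbreviation coins :: "nat \<Rightarrow> bool list set" where "coins s \<equiv> tuples s UNIV"

definition seeds :: "nat \<Rightarrow> nat \<Rightarrow> ('v list \<times> 'v list \<times> bool list) set" where
  "seeds k s = L k \<times> (L (2 * s) \<times> coins s)"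

lemma avg_seeds: "avg (seeds k s) \<phi> = avg (L k) (\<lambda>hs. avg (L (2 * s)) (\<lambda>ys. avg (coins s) (\<lambda>c. \<phi> (hs, ys, c))))"
  by (simp add: seeds_def avg_Times)

lemma avg_sel: "length c = s \<Longrightarrow> avg (L (2 * s)) (\<lambda>ys. \<phi> (sel c ys)) = avg (L s) \<phi>"
proof (induction c arbitrary: s \<phi>)
  case (Cons b c)
  then obtain s' where s: "s = Suc s'" "length c = s'" by auto
  have "avg (L (2 * s)) (\<lambda>ys. \<phi> (sel (b # c) ys))
    = avg W (\<lambda>u. avg W (\<lambda>v. avg (L s') (\<lambda>xs. \<phi> ((if b then u else v) # xs))))"
    using Cons.IH[OF s(2), of "\<lambda>xs. \<phi> (_ # xs)"] by (simp add: s(1) avg_tuples_Suc)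
  then show ?case by (cases b) (simp_all add: s(1) avg_tuples_Suc)
qed simp

text \<open>For each fixed choice of the coins the selected points are \<open>s\<close> independent
  uniform points. The coins serve to hide the last batch.\<close>

lemma avg_rejects: "avg (seeds k s) (\<lambda>\<omega>. of_bool (rejects f \<omega>)) = avg (L k) (\<lambda>hs. sum_rejection s (iter_diff hs f))"
  unfolding avg_seeds
proof (rule avg_cong)
  fix hs
  let ?\<phi> = "\<lambda>ys. of_bool (iter_diff hs f (sum_list ys) \<noteq> sum_list (map (iter_diff hs f) ys))"
  have "avg (L (2 * s)) (\<lambda>ys. avg (coins s) (\<lambda>c. of_bool (rejects f (hs, ys, c))))
     = avg (coins s) (\<lambda>c. avg (L (2 * s)) (\<lambda>ys. ?\<phi> (sel c ys)))"
    by (subst avg_swap) (simp add: rejects_def)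
  also have "\<dots> = avg (coins s) (\<lambda>c. avg (L s) ?\<phi>)"
    by (intro avg_cong avg_sel) (simp add: tuples_def)
  finally show "avg (L (2 * s)) (\<lambda>ys. avg (coins s) (\<lambda>c. of_bool (rejects f (hs, ys, c))))
     = sum_rejection s (iter_diff hs f)"
    by (simp add: avg_const sum_rejection_def)
qed

section \<open>Spread of the last batch\<close>

lemma avg_point: "a \<in> W \<Longrightarrow> real (card W) * avg W (\<lambda>z. of_bool (a = z) * \<phi> z) = \<phi> a"
  by (simp add: avg_def of_bool_def if_distrib[of "\<lambda>x. x * _"] sum.delta cong: if_cong)

text \<open>Compare the two coins of the first pair \<open>u\<close>, \<open>v\<close>. If they
  agree, which has probability 1/2, the common point cancels and the collision probability of the
  other pairs remains. If they differ, exactly one value of the fresh point makes the sums equal, so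
  the probability is \<open>1 / card W\<close>.\<close>

lemma sel_collision:
  "avg (L (2 * s)) (\<lambda>ys. avg (coins s) (\<lambda>c. avg (coins s) (\<lambda>c'.
     of_bool (sum_list (sel c ys) = sum_list (sel c' ys))))) \<le> (1/2) ^ s + 1 / real (card W)"
proof (induction s)
  case 0
  then show ?case by simp
next
  case (Suc s)
  let ?z = "\<lambda>c ys. sum_list (sel c ys)"
  let ?Q = "avg (L (2 * s)) (\<lambda>ys. avg (coins s) (\<lambda>c. avg (coins s) (\<lambda>c'. of_bool (?z c ys = ?z c' ys))))"
  have W: "?z c ys \<in> W" if "ys \<in> L k" for c ys k
    using that set_sel[of c ys] by (intro sum_list_W) (auto simp: tuples_W)
  have diff: "avg W (\<lambda>u. avg W (\<lambda>v. avg (L (2 * s)) (\<lambda>ys. avg (coins s) (\<lambda>c. avg (coins s) (\<lambda>c'.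
      of_bool (v + ?z c ys = u + ?z c' ys)))))) = 1 / real (card W)"
  proof -
    have "avg W (\<lambda>v. avg (L (2 * s)) (\<lambda>ys. avg (coins s) (\<lambda>c. avg (coins s) (\<lambda>c'.
      of_bool (v + ?z c ys = u + ?z c' ys))))) = avg (L (2 * s)) (\<lambda>ys. 1 / real (card W))" if u: "u \<in> W" for u
    proof -
      have "avg W (\<lambda>v. of_bool (v + ?z c ys = u + ?z c' ys)) = 1 / real (card W)" if "ys \<in> L (2 * s)" for ys c c'
      proof -
        have "v + ?z c ys = u + ?z c' ys \<longleftrightarrow> u + ?z c' ys + ?z c ys = v" if "v \<in> W" for v
          using add_self2(2)[OF W[OF \<open>ys \<in> L (2 * s)\<close>, of c]] by metis
        then have "avg W (\<lambda>v. of_bool (v + ?z c ys = u + ?z c' ys))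
          = avg W (\<lambda>v. of_bool (u + ?z c' ys + ?z c ys = v) * 1)"
          by (intro avg_cong) simp
        then show ?thesis
          using avg_point[of "u + ?z c' ys + ?z c ys" "\<lambda>_. 1"] u W[OF that] by (simp add: field_simps)
      qed
      then have "avg (L (2 * s)) (\<lambda>ys. avg (coins s) (\<lambda>c. avg (coins s) (\<lambda>c'. avg W (\<lambda>v.
          of_bool (v + ?z c ys = u + ?z c' ys))))) = avg (L (2 * s)) (\<lambda>ys. 1 / real (card W))"
        by (intro avg_cong) (simp add: avg_const)
      then show ?thesis
        by (simp only: avg_swap[where A = W and B = "L (2 * s)"] avg_swap[where A = W and B = "coins s"])
    qed
    then have "avg W (\<lambda>u. avg W (\<lambda>v. avg (L (2 * s)) (\<lambda>ys. avg (coins s) (\<lambda>c. avg (coins s) (\<lambda>c'.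
      of_bool (v + ?z c ys = u + ?z c' ys)))))) = avg W (\<lambda>u. avg (L (2 * s)) (\<lambda>ys. 1 / real (card W)))"
      by (rule avg_cong)
    then show ?thesis by simp
  qed
  have diff': "avg W (\<lambda>u. avg W (\<lambda>v. avg (L (2 * s)) (\<lambda>ys. avg (coins s) (\<lambda>c. avg (coins s) (\<lambda>c'.
      of_bool (u + ?z c ys = v + ?z c' ys)))))) = 1 / real (card W)"
    by (subst avg_swap) (rule diff)
  have "avg (L (2 * Suc s)) (\<lambda>ys. avg (coins (Suc s)) (\<lambda>c. avg (coins (Suc s)) (\<lambda>c'.
     of_bool (?z c ys = ?z c' ys))))
   = avg W (\<lambda>u. avg W (\<lambda>v. avg (L (2 * s)) (\<lambda>ys.
      1/2 * avg (coins s) (\<lambda>c. 1/2 * avg (coins s) (\<lambda>c'. of_bool (?z c ys = ?z c' ys))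
          + 1/2 * avg (coins s) (\<lambda>c'. of_bool (u + ?z c ys = v + ?z c' ys)))
    + 1/2 * avg (coins s) (\<lambda>c. 1/2 * avg (coins s) (\<lambda>c'. of_bool (v + ?z c ys = u + ?z c' ys))
          + 1/2 * avg (coins s) (\<lambda>c'. of_bool (?z c ys = ?z c' ys))))))"
    by (simp add: avg_tuples_Suc avg_bool)
  also have "\<dots> = 1/2 * (1/2 * ?Q + 1/2 * (1 / real (card W))) + 1/2 * (1/2 * (1 / real (card W)) + 1/2 * ?Q)"
    by (simp only: avg_add avg_cmult diff diff' avg_const_W)
  also have "\<dots> = ?Q / 2 + 1 / real (card W) / 2"
    by (simp add: field_simps)
  also have "\<dots> \<le> ((1/2) ^ s + 1 / real (card W)) / 2 + 1 / real (card W) / 2"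
    by (intro add_right_mono divide_right_mono Suc) simp
  finally show ?case by (simp add: field_simps)
qed

definition dens :: "'v set \<Rightarrow> real" where
  "dens E = avg W (\<lambda>y. of_bool (y \<in> E))"

lemma coset_hit:
  "set hs \<subseteq> W \<Longrightarrow> avg W (\<lambda>y. of_bool (set (pts hs y) \<inter> E \<noteq> {})) \<le> 2 ^ length hs * dens E"
proof (induction hs)
  case (Cons h hs)
  let ?P = "\<lambda>y. of_bool (set (pts hs y) \<inter> E \<noteq> {}) :: real"
  have "avg W (\<lambda>y. of_bool (set (pts (h # hs) y) \<inter> E \<noteq> {})) \<le> avg W (\<lambda>y. ?P y + ?P (y + h))"
    by (intro avg_mono of_bool_le_add) auto
  also have "\<dots> = 2 * avg W ?P"
    using Cons.prems avg_translate[of h ?P] by (simp only: avg_add) simp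
  also have "\<dots> \<le> 2 ^ length (h # hs) * dens E"
    using Cons by simp
  finally show ?case .
qed (simp add: dens_def)

text \<open>The erased set may depend on \<open>ys\<close> but not on the coins. With
  \<open>p z\<close> the probability that the coins produce the sum \<open>z\<close>, the inequality
  \<open>p z \<le> \<nu> / 2 + (p z) ^ 2 / (2 * \<nu>)\<close> separates the density of the bad
  points \<open>z\<close> from the sum of the squares \<open>(p z) ^ 2\<close>, which is the
  collision probability. The value of \<nu> is chosen later.\<close>

lemma last_batch_hit:
  assumes hs: "set hs \<subseteq> W" and lam: "\<nu> > 0"
    and E: "\<And>ys. ys \<in> L (2 * s) \<Longrightarrow> dens (E ys) \<le> \<kappa>"
  shows "avg (L (2 * s)) (\<lambda>ys. avg (coins s) (\<lambda>c. of_bool (set (pts hs (sum_list (sel c ys))) \<inter> E ys \<noteq> {})))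
    \<le> real (card W) * \<nu> * (2 ^ length hs * \<kappa>) / 2 + ((1/2) ^ s + 1 / real (card W)) / (2 * \<nu>)"
proof -
  let ?w = "real (card W)" and ?b = "2 ^ length hs :: real"
  let ?z = "\<lambda>c ys. sum_list (sel c ys)"
  let ?coll = "\<lambda>ys. avg (coins s) (\<lambda>c. avg (coins s) (\<lambda>c'. of_bool (?z c ys = ?z c' ys)))"
  have "avg (coins s) (\<lambda>c. of_bool (set (pts hs (?z c ys)) \<inter> E ys \<noteq> {}))
     \<le> ?w * \<nu> * (?b * \<kappa>) / 2 + ?coll ys / (2 * \<nu>)" if ys: "ys \<in> L (2 * s)" for ys
  proof -
    have W: "?z c ys \<in> W" for c
      using ys set_sel[of c ys] by (intro sum_list_W) (auto simp: tuples_W)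
    define I where "I z = (of_bool (set (pts hs z) \<inter> E ys \<noteq> {}) :: real)" for z
    define p where "p z = avg (coins s) (\<lambda>c. of_bool (?z c ys = z))" for z
    have coll: "?coll ys = ?w * avg W (\<lambda>z. p z * p z)"
    proof -
      have "?coll ys = avg (coins s) (\<lambda>c. avg (coins s) (\<lambda>c'. ?w * avg W (\<lambda>z. of_bool (?z c ys = z) * of_bool (?z c' ys = z))))"
        using W by (intro avg_cong) (subst avg_point, simp_all add: eq_commute)
      also have "\<dots> = ?w * avg W (\<lambda>z. avg (coins s) (\<lambda>c. of_bool (?z c ys = z) * avg (coins s) (\<lambda>c'. of_bool (?z c' ys = z))))"
        by (simp only: avg_cmult avg_swap[where A = "coins s" and B = W])
      also have "\<dots> = ?w * avg W (\<lambda>z. p z * p z)"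
        by (simp only: avg_multc p_def)
      finally show ?thesis .
    qed
    have "avg (coins s) (\<lambda>c. I (?z c ys)) = avg (coins s) (\<lambda>c. ?w * avg W (\<lambda>z. of_bool (?z c ys = z) * I z))"
      using W by (simp only: avg_point)
    also have "\<dots> = ?w * avg W (\<lambda>z. p z * I z)"
      by (simp only: avg_cmult avg_swap[where A = "coins s" and B = W] avg_multc p_def)
    also have "\<dots> \<le> ?w * avg W (\<lambda>z. (\<nu> / 2) * I z + 1 / (2 * \<nu>) * (p z * p z))"
    proof (intro mult_left_mono avg_mono)
      fix z
      have p: "0 \<le> p z" unfolding p_def by (intro avg_nonneg) simp
      have "2 * \<nu> * (p z * 1) \<le> \<nu> * \<nu> + p z * p z"
        using zero_le_square[of "\<nu> - p z"] by (simp add: algebra_simps)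
      then have "p z \<le> \<nu> / 2 + 1 / (2 * \<nu>) * (p z * p z)"
        using lam by (simp add: field_simps)
      then show "p z * I z \<le> (\<nu> / 2) * I z + 1 / (2 * \<nu>) * (p z * p z)"
        using lam p by (auto simp: I_def of_bool_def)
    qed simp
    also have "\<dots> = ?w * \<nu> * avg W I / 2 + ?coll ys / (2 * \<nu>)"
      unfolding coll by (simp only: avg_add avg_cmult) (simp add: algebra_simps)
    also have "avg W I \<le> ?b * \<kappa>"
      using order_trans[OF coset_hit[OF hs, of "E ys"] mult_left_mono[OF E[OF ys], of ?b]]
      by (simp add: I_def[abs_def])
    finally show ?thesis
      using lam by (simp add: I_def mult_left_mono divide_right_mono)
  qed
  then have "avg (L (2 * s)) (\<lambda>ys. avg (coins s) (\<lambda>c. of_bool (set (pts hs (?z c ys)) \<inter> E ys \<noteq> {})))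
    \<le> avg (L (2 * s)) (\<lambda>ys. ?w * \<nu> * (?b * \<kappa>) / 2 + 1 / (2 * \<nu>) * ?coll ys)"
    by (intro avg_mono) auto
  also have "\<dots> = ?w * \<nu> * (?b * \<kappa>) / 2 + 1 / (2 * \<nu>) * avg (L (2 * s)) ?coll"
    by (simp only: avg_add avg_cmult avg_const_L)
  also have "\<dots> \<le> ?w * \<nu> * (?b * \<kappa>) / 2 + 1 / (2 * \<nu>) * ((1/2) ^ s + 1 / ?w)"
    using lam by (intro add_left_mono mult_left_mono sel_collision) auto
  finally show ?thesis by simp
qed

section \<open>Probability of meeting an erasure\<close>

lemma length_concat_pts: "length (concat (map (pts hs) ys)) = length ys * 2 ^ length hs"
  by (induction ys) auto

lemma concat_pts_W: "set hs \<subseteq> W \<Longrightarrow> set ys \<subseteq> W \<Longrightarrow> set (concat (map (pts hs) ys)) \<subseteq> W"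
  using pts_W by fastforce

lemma batches_W:
  assumes "\<omega> \<in> seeds k s"
  shows "set (concat (batches \<omega>)) \<subseteq> W" "length (batches \<omega>) = 2 * s + 1"
    "length (concat (batches \<omega>)) = (2 * s + 1) * 2 ^ k" "\<forall>B\<in>set (batches \<omega>). length B = 2 ^ k"
proof -
  obtain hs ys c where \<omega>: "\<omega> = (hs, ys, c)" by (cases \<omega>)
  have *: "set hs \<subseteq> W" "length hs = k" "set ys \<subseteq> W" "length ys = 2 * s"
    using assms by (auto simp: \<omega> seeds_def tuples_W)
  moreover have "sum_list (sel c ys) \<in> W"
    using * set_sel[of c ys] by (intro sum_list_W) auto
  ultimately show "set (concat (batches \<omega>)) \<subseteq> W"
    using concat_pts_W[of hs "ys @ [sum_list (sel c ys)]"] by (simp add: \<omega> batches_def)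
  show "length (batches \<omega>) = 2 * s + 1" "\<forall>B\<in>set (batches \<omega>). length B = 2 ^ k"
    "length (concat (batches \<omega>)) = (2 * s + 1) * 2 ^ k"
    using * length_concat_pts[of hs "ys @ [sum_list (sel c ys)]"] by (auto simp: \<omega> batches_def)
qed

lemma seeds_finite_nonempty [simp]: "finite (seeds k s)" "seeds k s \<noteq> {}"
  by (auto simp: seeds_def)

text \<open>The first summand is for the \<open>2 * s\<close> batches of the pairs, the rest for the
  last batch. \<kappa> bounds the density of the erased sets.\<close>

definition hit_bound :: "nat \<Rightarrow> real \<Rightarrow> nat \<Rightarrow> real \<Rightarrow> real" where
  "hit_bound k \<kappa> s \<nu> = 2 * real s * (2 ^ k * \<kappa>) + (real (card W) * \<nu> * (2 ^ k * \<kappa>) / 2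
     + ((1/2) ^ s + 1 / real (card W)) / (2 * \<nu>))"

context
  fixes er :: "'v list \<Rightarrow> 'v set" and k N :: nat and \<kappa> :: real
  assumes er: "\<And>i qs. set qs \<subseteq> W \<Longrightarrow> length qs = i * 2 ^ k \<Longrightarrow> i \<le> N \<Longrightarrow> dens (er qs) \<le> \<kappa>"
begin

text \<open>The base point of the next batch is independent of the past queries, even if the
  adversary knows \<open>hs\<close> from them; thus each batch meets the current erased set with
  probability at most \<open>2 ^ k * \<kappa>\<close>.\<close>

lemma fresh_batches_hit:
  assumes hs: "hs \<in> L k"
  shows "set past \<subseteq> W \<Longrightarrow> length past = i * 2 ^ k \<Longrightarrow> i + j \<le> N \<Longrightarrow>
    avg (L j) (\<lambda>ys. of_bool (hit er past (map (pts hs) ys))) \<le> real j * (2 ^ k * \<kappa>)"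
proof (induction j arbitrary: past i)
  case (Suc j)
  have hs': "set hs \<subseteq> W" "length hs = k" using hs by (auto simp: tuples_W)
  have "avg (L (Suc j)) (\<lambda>ys. of_bool (hit er past (map (pts hs) ys)))
    \<le> avg W (\<lambda>y. avg (L j) (\<lambda>ys. of_bool (set (pts hs y) \<inter> er past \<noteq> {})
        + of_bool (hit er (past @ pts hs y) (map (pts hs) ys))))"
    unfolding avg_tuples_Suc by (intro avg_mono of_bool_le_add) auto
  also have "\<dots> = avg W (\<lambda>y. of_bool (set (pts hs y) \<inter> er past \<noteq> {}))
     + avg W (\<lambda>y. avg (L j) (\<lambda>ys. of_bool (hit er (past @ pts hs y) (map (pts hs) ys))))"
    by (simp only: avg_add avg_const_L)
  also have "avg W (\<lambda>y. of_bool (set (pts hs y) \<inter> er past \<noteq> {})) \<le> 2 ^ k * \<kappa>"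
  proof (rule order_trans[OF coset_hit[OF hs'(1)]])
    show "2 ^ length hs * dens (er past) \<le> 2 ^ k * \<kappa>"
      using er[OF Suc.prems(1,2)] Suc.prems(3) by (simp add: hs'(2))
  qed
  also have "avg W (\<lambda>y. avg (L j) (\<lambda>ys. of_bool (hit er (past @ pts hs y) (map (pts hs) ys))))
      \<le> real j * (2 ^ k * \<kappa>)"
    by (intro avg_le_const Suc.IH[where i = "Suc i"]) (use Suc.prems hs' pts_W in auto)
  finally show ?case by (simp add: algebra_simps)
qed simp

text \<open>The last batch is answered by the oracle in force after \<open>i + 2 * s\<close>
  batches. Its erased set depends on \<open>past\<close>, \<open>hs\<close> and \<open>ys\<close>
  but not on the coins, as \<open>last_batch_hit\<close> requires.\<close>

lemma round_hit:
  assumes past: "set past \<subseteq> W" "length past = i * 2 ^ k" "i + 2 * s \<le> N" and "\<nu> > 0"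
  shows "avg (seeds k s) (\<lambda>\<omega>. of_bool (hit er past (batches \<omega>))) \<le> hit_bound k \<kappa> s \<nu>"
  unfolding avg_seeds
proof (rule avg_le_const)
  fix hs assume hs: "hs \<in> L k"
  then have hs': "set hs \<subseteq> W" "length hs = k" by (auto simp: tuples_W)
  let ?past = "\<lambda>ys. past @ concat (map (pts hs) ys)"
  have "avg (L (2 * s)) (\<lambda>ys. avg (coins s) (\<lambda>c. of_bool (hit er past (batches (hs, ys, c)))))
    \<le> avg (L (2 * s)) (\<lambda>ys. avg (coins s) (\<lambda>c. of_bool (hit er past (map (pts hs) ys))
       + of_bool (set (pts hs (sum_list (sel c ys))) \<inter> er (?past ys) \<noteq> {})))"
    by (intro avg_mono of_bool_le_add) (simp add: batches_def hit_append)
  also have "\<dots> = avg (L (2 * s)) (\<lambda>ys. of_bool (hit er past (map (pts hs) ys)))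
    + avg (L (2 * s)) (\<lambda>ys. avg (coins s) (\<lambda>c. of_bool (set (pts hs (sum_list (sel c ys))) \<inter> er (?past ys) \<noteq> {})))"
    by (simp add: avg_add avg_const)
  also have "\<dots> \<le> real (2 * s) * (2 ^ k * \<kappa>) + (real (card W) * \<nu> * (2 ^ length hs * \<kappa>) / 2
     + ((1/2) ^ s + 1 / real (card W)) / (2 * \<nu>))"
  proof (intro add_mono fresh_batches_hit[OF hs past] last_batch_hit[OF hs'(1) assms(4)])
    fix ys assume "ys \<in> L (2 * s)"
    then show "dens (er (?past ys)) \<le> \<kappa>"
      using past hs' concat_pts_W[OF hs'(1), of ys]
      by (intro er[of _ "i + 2 * s"]) (auto simp: tuples_W length_concat_pts algebra_simps)
  qed
  finally show "avg (L (2 * s)) (\<lambda>ys. avg (coins s) (\<lambda>c. of_bool (hit er past (batches (hs, ys, c))))) \<le> hit_bound k \<kappa> s \<nu>"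
    using hs' by (simp add: hit_bound_def)
qed simp_all

lemma rounds_hit:
  assumes "\<nu> > 0"
  shows "set past \<subseteq> W \<Longrightarrow> length past = i * 2 ^ k \<Longrightarrow> i + m * (2 * s + 1) \<le> N \<Longrightarrow>
   avg (tuples m (seeds k s)) (\<lambda>\<omega>s. of_bool (hit er past (concat (map batches \<omega>s)))) \<le> real m * hit_bound k \<kappa> s \<nu>"
proof (induction m arbitrary: past i)
  case (Suc m)
  have "avg (tuples (Suc m) (seeds k s)) (\<lambda>\<omega>s. of_bool (hit er past (concat (map batches \<omega>s))))
    \<le> avg (seeds k s) (\<lambda>\<omega>. avg (tuples m (seeds k s)) (\<lambda>\<omega>s. of_bool (hit er past (batches \<omega>))
      + of_bool (hit er (past @ concat (batches \<omega>)) (concat (map batches \<omega>s)))))"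
    unfolding avg_tuples_Suc by (intro avg_mono of_bool_le_add) (simp add: hit_append)
  also have "\<dots> = avg (seeds k s) (\<lambda>\<omega>. of_bool (hit er past (batches \<omega>)))
    + avg (seeds k s) (\<lambda>\<omega>. avg (tuples m (seeds k s)) (\<lambda>\<omega>s.
        of_bool (hit er (past @ concat (batches \<omega>)) (concat (map batches \<omega>s)))))"
    by (simp add: avg_add avg_const)
  also have "\<dots> \<le> hit_bound k \<kappa> s \<nu> + real m * hit_bound k \<kappa> s \<nu>"
  proof (intro add_mono)
    show "avg (seeds k s) (\<lambda>\<omega>. of_bool (hit er past (batches \<omega>))) \<le> hit_bound k \<kappa> s \<nu>"
      by (rule round_hit[OF Suc.prems(1,2) _ assms]) (use Suc.prems in auto)
    show "avg (seeds k s) (\<lambda>\<omega>. avg (tuples m (seeds k s)) (\<lambda>\<omega>s.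
        of_bool (hit er (past @ concat (batches \<omega>)) (concat (map batches \<omega>s))))) \<le> real m * hit_bound k \<kappa> s \<nu>"
    proof (rule avg_le_const)
      fix \<omega> assume "\<omega> \<in> seeds k s"
      note B = batches_W[OF this]
      show "avg (tuples m (seeds k s)) (\<lambda>\<omega>s. of_bool (hit er (past @ concat (batches \<omega>)) (concat (map batches \<omega>s))))
        \<le> real m * hit_bound k \<kappa> s \<nu>"
        by (rule Suc.IH[where i = "i + (2 * s + 1)"]) (use Suc.prems B in \<open>auto simp: algebra_simps\<close>)
    qed simp_all
  qed
  finally show ?case by (simp add: algebra_simps)
qed simp

end


text \<open>If random iterated differences rarely fail, then \<open>f\<close> is close to its correction \<open>g\<close>, and a
  difference of \<open>f\<close> in \<open>k\<close> directions is an affine function plus the difference of the sparse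
  function \<open>f + g\<close>.\<close>

lemma rejects_prob:
  fixes f :: "'v \<Rightarrow> bit"
  assumes far: "\<And>g. (\<And>hs x. hs \<in> L (k + 2) \<Longrightarrow> x \<in> W \<Longrightarrow> iter_diff hs g x = 0)
      \<Longrightarrow> \<epsilon> \<le> avg W (\<lambda>x. of_bool (f x \<noteq> g x))"
    and \<epsilon>: "\<epsilon> > 0" and L: "L' \<ge> 1"
  shows "avg (seeds k (2 * L' + 1)) (\<lambda>\<omega>. of_bool (rejects f \<omega>))
    \<ge> min (1 / (6 * 4 ^ (k + 2))) (min 1 (2 * real L' * (2 ^ (k + 1) * \<epsilon>)) / 12)" (is "?p \<ge> _")
proof (cases "rejection (k + 2) f < 1 / (3 * 4 ^ (k + 2))")
  case False
  \<comment> \<open>\<open>L' \<ge> 1\<close> provides the two points that the four-point comparison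
    exchanges; a round then rejects with at least half the probability of the flat test.\<close>
  obtain r where r: "2 * L' + 1 = Suc (Suc r)" using L by (cases L') auto
  have "rejection (k + 2) f \<le> 2 * ?p"
    using rejection_le_sum_rejection[of k f r] unfolding avg_rejects r by simp
  then have "1 / (3 * 4 ^ (k + 2)) \<le> 2 * ?p" using False by linarith
  then have "1 / (6 * 4 ^ (k + 2)) \<le> ?p" by (simp add: field_simps)
  then show ?thesis by (rule min.coboundedI1)
next
  case True
  define g where "g = correction (k + 2) f"
  define e where "e = (\<lambda>x. f x + g x)"
  define \<mu> where "\<mu> = avg W (\<lambda>x. of_bool (e x \<noteq> 0))"
  define N where "N = 2 ^ k * \<mu>"
  define \<beta> where "\<beta> hs = avg W (\<lambda>x. of_bool (iter_diff hs e x \<noteq> 0))" for hs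
  let ?r = "2 * L'"
  define M where "M = min 1 (real ?r * (2 * N))"
  \<comment> \<open>The threshold that separates the two cases is the one below which all
    differences of the correction in \<open>k + 2\<close> directions vanish.\<close>
  have g0: "iter_diff hs g x = 0" if "hs \<in> L (k + 2)" "x \<in> W" for hs x
    unfolding g_def using True that by (intro correction_iter_diff_zero) (auto simp: field_simps)
  have e0: "e x \<noteq> 0 \<longleftrightarrow> f x \<noteq> g x" for x
    unfolding e_def by (simp only: bit_add_eq_0)
  have "\<epsilon> \<le> \<mu>" unfolding \<mu>_def e0 by (rule far) (rule g0)
  have N0: "N > 0" using \<open>\<epsilon> \<le> \<mu>\<close> \<epsilon> by (simp add: N_def)
  have "\<mu> \<le> 2 * rejection (k + 2) f"
    unfolding \<mu>_def e0 unfolding g_def by (rule correction_dist)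
  also have "\<dots> \<le> 2 * (1 / (3 * 4 ^ (k + 2)))" using True by simp
  finally have "N \<le> 2 ^ k * (2 * (1 / (3 * 4 ^ (k + 2))))" unfolding N_def by (rule mult_left_mono) simp
  also have "\<dots> = 1 / (24 * 2 ^ k)"
    using power_mult_distrib[of "2::real" 2 k] by (simp add: field_simps)
  also have "\<dots> \<le> 1 / 24" by (simp add: field_simps)
  finally have N1: "N \<le> 1 / 24" .
  \<comment> \<open>The bound \<open>min 1 (?r * (2 * \<beta> hs))\<close> is concave in
    \<open>\<beta> hs\<close>. On the interval from 0 to \<open>N\<close> it lies above its chord
    \<open>M / N * \<beta> hs\<close>, which is linear and can be averaged over \<open>hs\<close>.
    The factor 11/12 is \<open>1 - 2 / 24\<close>.\<close>
  have lower: "sum_rejection (2 * L' + 1) (iter_diff hs f) \<ge> (11 * M / (48 * N)) * \<beta> hs" if hs: "hs \<in> L k" for hs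
  proof -
    have b: "0 \<le> \<beta> hs" "\<beta> hs \<le> N"
      using support_iter_diff_upper[of hs e] hs unfolding \<beta>_def N_def \<mu>_def
      by (auto intro!: avg_nonneg simp: tuples_W)
    then have b2: "0 \<le> 2 * \<beta> hs" "2 * \<beta> hs \<le> 1" using N1 by auto
    have "sum_rejection (Suc ?r) (iter_diff hs f) \<ge> (1 - 2 * \<beta> hs) * ((1 - (1 - 2 * \<beta> hs) ^ ?r) / 2)"
      unfolding \<beta>_def
    proof (rule sum_rejection_sparse)
      fix x a b assume "x \<in> W" "a \<in> W" "b \<in> W"
      then show "iter_diff [a, b] (iter_diff hs g) x = 0"
        using g0[of "[a, b] @ hs" x] hs by (simp only: iter_diff_append) (auto simp: tuples_W)
    next
      fix x
      have "f = (\<lambda>x. g x + e x)" unfolding e_def by (simp add: fun_eq_iff ac_simps)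
      then show "iter_diff hs f x = iter_diff hs g x + iter_diff hs e x"
        using iter_diff_add[of hs g e x] by simp
    qed simp
    moreover have "(11 / 12) * ((M / N * \<beta> hs / 2) / 2) \<le> (1 - 2 * \<beta> hs) * ((1 - (1 - 2 * \<beta> hs) ^ ?r) / 2)"
    proof (intro mult_mono divide_right_mono)
      have "M / N * \<beta> hs \<le> min 1 (real ?r * (2 * \<beta> hs))"
      proof (rule min.boundedI)
        have "M / N * \<beta> hs \<le> 1 / N * N"
          using b N0 by (intro mult_mono divide_right_mono) (auto simp: M_def)
        then show "M / N * \<beta> hs \<le> 1" using N0 by simp
        have "M / N * \<beta> hs \<le> (real ?r * (2 * N)) / N * \<beta> hs"
          using b N0 by (intro mult_right_mono divide_right_mono) (auto simp: M_def)
        then show "M / N * \<beta> hs \<le> real ?r * (2 * \<beta> hs)" using N0 by simp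
      qed
      then have "M / N * \<beta> hs / 2 \<le> min 1 (real ?r * (2 * \<beta> hs)) / 2"
        by (rule divide_right_mono) simp
      also note one_minus_power_ge[OF b2, of ?r]
      finally show "M / N * \<beta> hs / 2 \<le> 1 - (1 - 2 * \<beta> hs) ^ ?r" .
    qed (use b N0 N1 in \<open>auto simp: M_def\<close>)
    ultimately show ?thesis by (simp add: field_simps)
  qed
  have M0: "0 \<le> M" using N0 by (simp add: M_def)
  have "N * (1 - N) \<le> avg (L k) \<beta>"
    using support_iter_diff_lower[of k e] N1 by (simp add: \<beta>_def[abs_def] N_def \<mu>_def)
  then have "11 * M / (48 * N) * (N * (1 - N)) \<le> 11 * M / (48 * N) * avg (L k) \<beta>"
    using N0 M0 by (intro mult_left_mono) auto
  also have "\<dots> = avg (L k) (\<lambda>hs. 11 * M / (48 * N) * \<beta> hs)"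
    by (simp only: avg_cmult)
  also have "\<dots> \<le> ?p"
    unfolding avg_rejects by (intro avg_mono lower)
  finally have "11 * M / 48 * (1 - N) \<le> ?p" using N0 by simp
  moreover have "M * (1 - N) \<ge> M * (23 / 24)" using N1 M0 by (intro mult_left_mono) auto
  ultimately have "M / 12 \<le> ?p" using M0 by simp
  moreover have "min 1 (2 * real L' * (2 ^ (k + 1) * \<epsilon>)) \<le> M"
    unfolding M_def N_def using \<open>\<epsilon> \<le> \<mu>\<close> by (intro min.mono) (auto intro!: mult_left_mono)
  ultimately have "min 1 (2 * real L' * (2 ^ (k + 1) * \<epsilon>)) / 12 \<le> ?p"
    by (meson divide_right_mono order_trans zero_le_numeral)
  then show ?thesis by (rule min.coboundedI2)
qed

text \<open>Rounds are independent and \<open>(1 - p) ^ m \<le> 1 / (1 + m * p)\<close>; the 5 makes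
  this at most 1/6.\<close>

lemma all_rounds_accept:
  assumes "real m * avg (seeds k s) (\<lambda>\<omega>. of_bool (rejects f \<omega>)) \<ge> 5"
  shows "avg (tuples m (seeds k s)) (\<lambda>\<omega>s. of_bool (\<forall>\<omega>\<in>set \<omega>s. \<not> rejects f \<omega>)) \<le> 1/6"
proof -
  let ?p = "avg (seeds k s) (\<lambda>\<omega>. of_bool (rejects f \<omega>))"
  have p: "0 \<le> ?p" "?p \<le> 1" by (rule avg_of_bool_range; simp)+
  have "avg (tuples m (seeds k s)) (\<lambda>\<omega>s. of_bool (\<forall>\<omega>\<in>set \<omega>s. \<not> rejects f \<omega>)) = (1 - ?p) ^ m"
    by (simp only: avg_tuples_all) (simp add: avg_of_bool_not)
  also have "\<dots> \<le> 1/6"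
  proof -
    have "(1 - ?p) ^ m * (1 + real m * ?p) \<le> 1"
      using p by (rule power_one_minus_mult_le)
    moreover have "(1 - ?p) ^ m * 6 \<le> (1 - ?p) ^ m * (1 + real m * ?p)"
      using p assms by (intro mult_left_mono) auto
    ultimately show ?thesis by simp
  qed
  finally show ?thesis .
qed

end

section \<open>Nonadaptive algorithms\<close>

primrec chain :: "'a list \<Rightarrow> ('b option list \<Rightarrow> bool) \<Rightarrow> ('a, 'b) algorithm" where
  "chain [] v = Halt (v [])"
| "chain (x # xs) v = Query x (\<lambda>a. chain xs (\<lambda>as. v (a # as)))"

text \<open>The oracle is chosen as in \<open>run\<close>: only completed batches are visible to the
  adversary.\<close>

primrec answers :: "nat \<Rightarrow> ('a, 'b) strategy \<Rightarrow> 'a list \<Rightarrow> 'a list \<Rightarrow> 'b option list" where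
  "answers b A qs [] = []"
| "answers b A qs (x # xs) = A (take (length qs div b * b) qs) x # answers b A (qs @ [x]) xs"

lemma query_complexity_chain: "query_complexity (chain xs v) = enat (length xs)"
  by (induction xs arbitrary: v) (auto simp: eSuc_enat zero_enat_def)

lemma queried_chain: "queried (chain xs v) = set xs"
  by (induction xs arbitrary: v) auto

lemma run_chain: "run b A (chain xs v) qs = return_pmf (v (answers b A qs xs))"
  by (induction xs arbitrary: v qs) auto

lemma length_answers [simp]: "length (answers b A qs xs) = length xs"
  by (induction xs arbitrary: qs) auto

lemma answers_append: "answers b A qs (xs @ ys) = answers b A qs xs @ answers b A (qs @ xs) ys"
  by (induction xs arbitrary: qs) auto

text \<open>Until the batch is complete, rounding the number of queries down to a multiple of
  \<open>b\<close> gives the length of \<open>past\<close>.\<close>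

lemma answers_batch:
  assumes "length past = i * b"
  shows "length pre + length xs \<le> b \<Longrightarrow> answers b A (past @ pre) xs = map (A past) xs"
proof (induction xs arbitrary: pre)
  case (Cons x xs)
  then have "length (past @ pre) div b = i" using assms by (simp add: div_nat_eqI)
  then have "take (length (past @ pre) div b * b) (past @ pre) = past" using assms by simp
  then show ?case using Cons.IH[of "pre @ [x]"] Cons.prems by simp
qed simp

lemma answers_None_iff_hit:
  assumes "length past = i * b" "\<forall>B\<in>set Bs. length B = b \<and> set B \<subseteq> X"
  shows "None \<in> set (answers b A past (concat Bs)) \<longleftrightarrow> hit (\<lambda>qs. {x \<in> X. A qs x = None}) past Bs"
  using assms
proof (induction Bs arbitrary: past i)
  case (Cons B Bs)
  have "answers b A past B = map (A past) B"
    using answers_batch[OF Cons.prems(1), of "[]" B A] Cons.prems by simp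
  moreover have "None \<in> A past ` set B \<longleftrightarrow> set B \<inter> {x \<in> X. A past x = None} \<noteq> {}"
    using Cons.prems(2) by force
  moreover have "None \<in> set (answers b A (past @ B) (concat Bs)) \<longleftrightarrow> hit (\<lambda>qs. {x \<in> X. A qs x = None}) (past @ B) Bs"
    using Cons.prems by (intro Cons.IH[where i = "Suc i"]) auto
  ultimately show ?case by (simp add: answers_append)
qed simp

text \<open>Induction on the completed batches: the first oracle is \<open>f\<close>, and each later
  one can only erase values of its predecessor.\<close>

lemma adversary_answer:
  assumes "erasure_budget_adversary X b t f A" "set qs \<subseteq> X" "length qs = i * b" "x \<in> X"
  shows "A qs x \<in> {Some (f x), None}"
  using assms(2,3)
proof (induction i arbitrary: qs)
  case 0
  then show ?case using assms by (auto simp: erasure_budget_adversary_def)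
next
  case (Suc i)
  let ?p = "take (i * b) qs" and ?B = "drop (i * b) qs"
  have p: "set ?p \<subseteq> X" "set ?B \<subseteq> X" "length ?p = i * b" "length ?B = b"
    using Suc.prems set_take_subset[of "i * b" qs] set_drop_subset[of "i * b" qs] by auto
  then have "A (?p @ ?B) x \<in> {A ?p x, None}"
    using assms(1,4) unfolding erasure_budget_adversary_def by blast
  then show ?case using Suc.IH[OF p(1,3)] by auto
qed

lemma answers_true_value:
  assumes "erasure_budget_adversary X b t f A" "set qs \<subseteq> X" "set xs \<subseteq> X"
    and "None \<notin> set (answers b A qs xs)"
  shows "answers b A qs xs = map (\<lambda>x. Some (f x)) xs"
  using assms(2-)
proof (induction xs arbitrary: qs)
  case (Cons x xs)
  let ?p = "take (length qs div b * b) qs"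
  have "A ?p x \<in> {Some (f x), None}"
    using Cons.prems set_take_subset[of "length qs div b * b" qs]
    by (intro adversary_answer[OF assms(1), where i = "length qs div b"]) auto
  then show ?case using Cons by auto
qed simp

text \<open>\<open>R\<close> will inspect its argument at queried points only, so the junk values of \<open>the\<close>
  elsewhere are harmless.\<close>

definition cautious_verdict :: "'a list \<Rightarrow> (('a \<Rightarrow> 'b) \<Rightarrow> bool) \<Rightarrow> 'b option list \<Rightarrow> bool" where
  "cautious_verdict xs R as \<longleftrightarrow> None \<in> set as \<or> \<not> R (\<lambda>x. the (the (map_of (zip xs as) x)))"

lemma cautious_verdict_answers:
  assumes "erasure_budget_adversary X b t f A" "set xs \<subseteq> X"
    and R: "\<And>g. (\<And>x. x \<in> set xs \<Longrightarrow> g x = f x) \<Longrightarrow> R g = R f"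
  shows "cautious_verdict xs R (answers b A [] xs) \<longleftrightarrow> None \<in> set (answers b A [] xs) \<or> \<not> R f"
proof (cases "None \<in> set (answers b A [] xs)")
  case False
  have "answers b A [] xs = map (\<lambda>x. Some (f x)) xs"
    by (rule answers_true_value[OF assms(1) _ assms(2) False]) simp
  then have "R (\<lambda>x. the (the (map_of (zip xs (answers b A [] xs)) x))) = R f"
    by (intro R) (simp add: map_of_zip_map)
  then show ?thesis using False by (simp add: cautious_verdict_def)
qed (simp add: cautious_verdict_def)

lemma pmf_run_Toss_chain:
  assumes "finite S" "S \<noteq> {}"
  shows "pmf (run b A (Toss (map_pmf (\<lambda>\<omega>. chain (Q \<omega>) (v \<omega>)) (pmf_of_set S))) []) r
    = avg S (\<lambda>\<omega>. of_bool (v \<omega> (answers b A [] (Q \<omega>)) = r))"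
proof -
  have "run b A (Toss (map_pmf (\<lambda>\<omega>. chain (Q \<omega>) (v \<omega>)) (pmf_of_set S))) []
    = map_pmf (\<lambda>\<omega>. v \<omega> (answers b A [] (Q \<omega>))) (pmf_of_set S)"
    unfolding run_Toss by (simp only: bind_map_pmf run_chain) (simp add: map_pmf_def)
  then show ?thesis
    using assms by (simp add: pmf_map measure_pmf_of_set avg_of_bool vimage_def Int_def)
qed

lemma query_complexity_Toss_chain:
  assumes "finite S" "S \<noteq> {}" "\<And>\<omega>. \<omega> \<in> S \<Longrightarrow> length (Q \<omega>) = q"
  shows "query_complexity (Toss (map_pmf (\<lambda>\<omega>. chain (Q \<omega>) (v \<omega>)) (pmf_of_set S))) = enat q"
proof -
  have "(\<lambda>\<omega>. query_complexity (chain (Q \<omega>) (v \<omega>))) ` S = {enat q}"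
    using assms by (auto simp: query_complexity_chain)
  then show ?thesis using assms by (simp add: image_image)
qed

lemma queried_Toss_chain:
  assumes "finite S" "S \<noteq> {}"
  shows "queried (Toss (map_pmf (\<lambda>\<omega>. chain (Q \<omega>) (v \<omega>)) (pmf_of_set S))) = (\<Union>\<omega>\<in>S. set (Q \<omega>))"
  using assms by (simp add: queried_chain)

section \<open>Low degree and vanishing differences\<close>

text \<open>A copy of \<open>cube n\<close> that is a subgroup of the functions with pointwise
  addition: outside \<open>{1..n}\<close> the value is 0 instead of
  \<open>undefined\<close>.\<close>

definition points :: "nat \<Rightarrow> (nat \<Rightarrow> bit) set" where
  "points n = {x. \<forall>i. i \<notin> {1..n} \<longrightarrow> x i = 0}"

definition to_cube :: "nat \<Rightarrow> (nat \<Rightarrow> bit) \<Rightarrow> nat \<Rightarrow> bit" where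
  "to_cube n x = restrict x {1..n}"

definition of_cube :: "nat \<Rightarrow> (nat \<Rightarrow> bit) \<Rightarrow> nat \<Rightarrow> bit" where
  "of_cube n x = (\<lambda>i. if i \<in> {1..n} then x i else 0)"

lemma of_to_cube [simp]: "x \<in> points n \<Longrightarrow> of_cube n (to_cube n x) = x"
  by (auto simp: points_def to_cube_def of_cube_def fun_eq_iff)

lemma to_of_cube [simp]: "x \<in> cube n \<Longrightarrow> to_cube n (of_cube n x) = x"
  by (auto simp: cube_def to_cube_def of_cube_def fun_eq_iff PiE_def extensional_def)

lemma to_cube_mem [simp]: "to_cube n x \<in> cube n" and of_cube_mem [simp]: "of_cube n x \<in> points n"
  by (auto simp: cube_def to_cube_def of_cube_def points_def)

lemma bij_to_cube: "bij_betw (to_cube n) (points n) (cube n)"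
  by (rule bij_betwI[of _ _ _ "of_cube n"]) auto

lemma UNIV_bit: "(UNIV :: bit set) = {0, 1}"
  using bit.exhaust by auto

lemma card_UNIV_bit: "card (UNIV :: bit set) = 2" and finite_UNIV_bit: "finite (UNIV :: bit set)"
  by (simp_all add: UNIV_bit)

lemma card_cube: "card (cube n) = 2 ^ n" and finite_cube: "finite (cube n)"
  unfolding cube_def by (simp_all add: card_PiE card_UNIV_bit finite_UNIV_bit finite_PiE)

lemma card_points: "card (points n) = 2 ^ n"
  using bij_betw_same_card[OF bij_to_cube] card_cube by simp

interpretation cube: boolean_group "points n" for n
proof
  show "finite (points n)"
    using bij_betw_finite[OF bij_to_cube] finite_cube by simp
qed (auto simp: points_def fun_eq_iff)

lemma iter_diff_zero [simp]: "iter_diff hs (\<lambda>_. 0) x = 0"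
  by (induction hs arbitrary: x) auto

lemma iter_diff_cmult: "iter_diff hs (\<lambda>y. c * f y) x = c * iter_diff hs f x"
  by (induction hs arbitrary: x) (auto simp: distrib_left)

lemma iter_diff_sum: "iter_diff hs (\<lambda>y. \<Sum>j\<in>J. f j y) x = (\<Sum>j\<in>J. iter_diff hs (f j) x)"
  by (induction hs arbitrary: x) (auto simp: sum.distrib)

text \<open>Multiplication by a coordinate raises the degree by at most one, by the product rule
  \<open>y i * g y + (y + h) i * g (y + h) = y i * (g y + g (y + h)) + h i * g (y + h)\<close>. The
  induction applies to the difference of \<open>g\<close> along \<open>h\<close>, while the last
  summand is covered by the assumption on \<open>g\<close>.\<close>

lemma iter_diff_mult_coordinate:
  fixes g :: "(nat \<Rightarrow> bit) \<Rightarrow> bit"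
  assumes "\<And>hs x. length hs = k \<Longrightarrow> iter_diff hs g x = 0" "length hs = Suc k"
  shows "iter_diff hs (\<lambda>x. x i * g x) x = 0"
  using assms
proof (induction k arbitrary: g hs x)
  case 0
  then show ?case using "0.prems"(1)[of "[]"] by (auto simp: length_Suc_conv)
next
  case (Suc k)
  obtain h hs' where hs: "hs = h # hs'" "length hs' = Suc k"
    using Suc.prems(2) by (auto simp: length_Suc_conv)
  have "iter_diff hs (\<lambda>x. x i * g x) x = iter_diff hs' (\<lambda>y. y i * (g y + g (y + h)) + h i * g (y + h)) x"
    unfolding hs iter_diff_Cons by (rule arg_cong[where f = "\<lambda>F. iter_diff hs' F x"]) (simp add: fun_eq_iff algebra_simps)
  also have "\<dots> = iter_diff hs' (\<lambda>y. y i * (g y + g (y + h))) x + h i * iter_diff hs' g (x + h)"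
    by (simp only: iter_diff_add iter_diff_cmult iter_diff_translate)
  also have "iter_diff hs' g (x + h) = 0"
    using Suc.prems(1) hs(2) .
  also have "iter_diff hs' (\<lambda>y. y i * (g y + g (y + h))) x = 0"
  proof (rule Suc.IH[OF _ hs(2)])
    fix as y assume "length (as :: (nat \<Rightarrow> bit) list) = k"
    then have "iter_diff (h # as) g y = 0" by (intro Suc.prems(1)) simp
    then show "iter_diff as (\<lambda>y. g y + g (y + h)) y = 0" unfolding iter_diff_Cons .
  qed
  finally show ?case by simp
qed

lemma iter_diff_monomial:
  fixes S :: "nat set"
  assumes "finite S"
  shows "card S < length hs \<Longrightarrow> iter_diff hs (\<lambda>x. \<Prod>i\<in>S. (x i :: bit)) x = 0"
proof -
  have "iter_diff hs (\<lambda>x. \<Prod>i\<in>S. (x i :: bit)) x = 0" if "length hs = Suc (card S)" for hs x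
    using assms that
  proof (induction S arbitrary: hs x rule: finite_induct)
    case empty
    then show ?case by (auto simp: length_Suc_conv)
  next
    case (insert i S)
    then show ?case
      using iter_diff_mult_coordinate[of "Suc (card S)" "\<lambda>x. \<Prod>i\<in>S. x i" hs i x] by simp
  qed
  note * = this
  assume less: "card S < length hs"
  then obtain as bs where "hs = as @ bs" "length bs = Suc (card S)"
    by (metis Suc_leI append_take_drop_id length_drop diff_diff_cancel)
  then have "iter_diff hs (\<lambda>x. \<Prod>i\<in>S. (x i :: bit)) x = iter_diff as (\<lambda>_. 0) x"
    by (simp add: iter_diff_append *[THEN ext])
  then show ?thesis by simp
qed

lemma low_degree_imp_iter_diff:
  assumes "f \<in> low_degree n d" "set hs \<subseteq> points n" "d < length hs" "x \<in> points n"
  shows "iter_diff hs (\<lambda>x. f (to_cube n x)) x = 0"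
proof -
  obtain M where M: "M \<subseteq> {S. S \<subseteq> {1..n} \<and> card S \<le> d}"
    "\<And>x. x \<in> cube n \<Longrightarrow> f x = (\<Sum>S\<in>M. \<Prod>i\<in>S. x i)"
    using assms(1) unfolding low_degree_def by blast
  have "iter_diff hs (\<lambda>x. f (to_cube n x)) x = iter_diff hs (\<lambda>x. \<Sum>S\<in>M. \<Prod>i\<in>S. x i) x"
  proof (rule cube.iter_diff_cong[OF _ assms(2,4)])
    fix x
    have "(\<Prod>i\<in>S. to_cube n x i) = (\<Prod>i\<in>S. x i)" if "S \<in> M" for S
    proof -
      have "S \<subseteq> {1..n}" using that M(1) by blast
      then show ?thesis by (intro prod.cong) (auto simp: to_cube_def)
    qed
    then show "f (to_cube n x) = (\<Sum>S\<in>M. \<Prod>i\<in>S. x i)" by (simp add: M(2))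
  qed
  also have "\<dots> = 0"
    unfolding iter_diff_sum
  proof (intro sum.neutral ballI)
    fix S assume "S \<in> M"
    then have "S \<subseteq> {1..n}" "card S \<le> d" using M(1) by blast+
    then have "finite S" "card S < length hs" using assms(3) finite_subset[of S "{1..n}"] by simp_all
    then show "iter_diff hs (\<lambda>x. \<Prod>i\<in>S. x i) x = 0" by (rule iter_diff_monomial)
  qed
  finally show ?thesis .
qed

section \<open>Moebius inversion over subsets of coordinates\<close>

definition unit_vec :: "nat \<Rightarrow> nat \<Rightarrow> bit" where
  "unit_vec i = (\<lambda>j. of_bool (j = i))"

definition char_vec :: "nat set \<Rightarrow> nat \<Rightarrow> bit" where
  "char_vec S = (\<lambda>j. of_bool (j \<in> S))"

text \<open>At \<open>x = 0\<close> this is the coefficient of the monomial of \<open>S\<close> in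
  the algebraic normal form of \<open>g\<close>.\<close>

definition subset_sum :: "((nat \<Rightarrow> bit) \<Rightarrow> bit) \<Rightarrow> (nat \<Rightarrow> bit) \<Rightarrow> nat set \<Rightarrow> bit" where
  "subset_sum g x S = (\<Sum>T\<in>Pow S. g (x + char_vec T))"

lemma char_vec_insert: "i \<notin> S \<Longrightarrow> char_vec (insert i S) = unit_vec i + char_vec S"
  by (auto simp: char_vec_def unit_vec_def fun_eq_iff)

lemma char_vec_empty [simp]: "char_vec {} = 0"
  by (simp add: char_vec_def fun_eq_iff)

lemma sum_Pow_insert:
  "finite S \<Longrightarrow> a \<notin> S \<Longrightarrow> (\<Sum>T\<in>Pow (insert a S). \<phi> T) = (\<Sum>T\<in>Pow S. \<phi> T) + (\<Sum>T\<in>Pow S. \<phi> (insert a T))"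
proof -
  assume S: "finite S" "a \<notin> S"
  have "inj_on (insert a) (Pow S)"
    using S(2) by (intro inj_onI) (metis PowD insert_ident subsetD)
  then have "(\<Sum>T\<in>insert a ` Pow S. \<phi> T) = (\<Sum>T\<in>Pow S. \<phi> (insert a T))"
    by (simp add: sum.reindex)
  then show ?thesis
    unfolding Pow_insert using S by (subst sum.union_disjoint) auto
qed

lemma subset_sum_insert:
  assumes "finite S" "i \<notin> S"
  shows "subset_sum g x (insert i S) = subset_sum g x S + subset_sum g (x + unit_vec i) S"
proof -
  have "(\<Sum>T\<in>Pow S. g (x + char_vec (insert i T))) = (\<Sum>T\<in>Pow S. g (x + unit_vec i + char_vec T))"
  proof (intro sum.cong refl)
    fix T assume "T \<in> Pow S"
    then have "i \<notin> T" using assms(2) by auto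
    then show "g (x + char_vec (insert i T)) = g (x + unit_vec i + char_vec T)"
      by (simp add: char_vec_insert add.assoc)
  qed
  then show ?thesis unfolding subset_sum_def sum_Pow_insert[OF assms] by simp
qed

lemma newton_expansion: "finite A \<Longrightarrow> g (x + char_vec A) = (\<Sum>S\<in>Pow A. subset_sum g x S)"
proof (induction A arbitrary: x rule: finite_induct)
  case empty
  then show ?case by (simp add: subset_sum_def)
next
  case (insert a A)
  have "g (x + char_vec (insert a A)) = g (x + unit_vec a + char_vec A)"
    using insert by (simp add: char_vec_insert ac_simps)
  also have "\<dots> = (\<Sum>S\<in>Pow A. subset_sum g (x + unit_vec a) S)" by (rule insert.IH)
  also have "\<dots> = (\<Sum>S\<in>Pow A. subset_sum g x S + subset_sum g x (insert a S))"
  proof (intro sum.cong refl)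
    fix S assume "S \<in> Pow A"
    then have "finite S" "a \<notin> S" using insert finite_subset by auto
    then show "subset_sum g (x + unit_vec a) S = subset_sum g x S + subset_sum g x (insert a S)"
      by (simp add: subset_sum_insert)
  qed
  also have "\<dots> = (\<Sum>S\<in>Pow (insert a A). subset_sum g x S)"
    unfolding sum_Pow_insert[OF insert(1,2)] by (rule sum.distrib)
  finally show ?case .
qed

lemma subset_sum_eq_iter_diff:
  "distinct xs \<Longrightarrow> subset_sum g x (set xs) = iter_diff (map unit_vec xs) g x"
  by (induction xs arbitrary: x) (auto simp: subset_sum_insert, simp add: subset_sum_def)

text \<open>The coefficient of \<open>S\<close> is the difference at 0 in the unit directions of
  \<open>S\<close>, so it vanishes for \<open>card S > d\<close>. The other coefficients give the
  polynomial.\<close>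

lemma iter_diff_imp_low_degree:
  assumes "\<And>hs x. hs \<in> tuples (Suc d) (points n) \<Longrightarrow> x \<in> points n \<Longrightarrow> iter_diff hs g x = 0"
  shows "(\<lambda>x. g (of_cube n x)) \<in> low_degree n d"
proof -
  have zero: "subset_sum g 0 S = 0" if S: "S \<subseteq> {1..n}" "d < card S" for S
  proof -
    define hs where "hs = map unit_vec (sorted_list_of_set S)"
    have fin: "finite S" using S(1) finite_subset by auto
    have W: "set hs \<subseteq> points n"
      using S(1) fin by (auto simp: hs_def points_def unit_vec_def)
    have "length hs \<ge> Suc d" using S(2) by (simp add: hs_def)
    \<comment> \<open>The last \<open>Suc d\<close> directions already annihilate \<open>g\<close>;
      the others then act on the zero function.\<close>
    then obtain as bs where ab: "hs = as @ bs" "length bs = Suc d"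
      by (metis append_take_drop_id length_drop diff_diff_cancel)
    have "subset_sum g 0 S = iter_diff hs g 0"
      unfolding hs_def using fin by (subst subset_sum_eq_iter_diff[symmetric]) auto
    also have "\<dots> = iter_diff as (\<lambda>_. 0) 0"
      unfolding ab(1) iter_diff_append
      by (rule cube.iter_diff_cong[where n = n]) (use W ab assms in \<open>auto simp: tuples_def\<close>)
    finally show ?thesis by simp
  qed
  define M where "M = {S. S \<subseteq> {1..n} \<and> card S \<le> d \<and> subset_sum g 0 S = 1}"
  have "g (of_cube n x) = (\<Sum>S\<in>M. \<Prod>i\<in>S. x i)" if "x \<in> cube n" for x
  proof -
    define A where "A = {i \<in> {1..n}. x i = 1}"
    have "of_cube n x = 0 + char_vec A"
      by (auto simp: of_cube_def char_vec_def A_def fun_eq_iff)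
    then have "g (of_cube n x) = (\<Sum>S\<in>Pow A. subset_sum g 0 S)"
      using newton_expansion[of A g 0] by (simp add: A_def)
    also have "\<dots> = (\<Sum>S\<in>{S \<in> M. S \<subseteq> A}. 1)"
    proof (rule sum.mono_neutral_cong_right)
      show "\<forall>S\<in>Pow A - {S \<in> M. S \<subseteq> A}. subset_sum g 0 S = 0"
      proof
        fix S assume "S \<in> Pow A - {S \<in> M. S \<subseteq> A}"
        then have "S \<subseteq> {1..n}" "subset_sum g 0 S \<noteq> 1 \<or> d < card S" by (auto simp: M_def A_def)
        then show "subset_sum g 0 S = 0" using zero[of S] by auto
      qed
    qed (auto simp: M_def A_def)
    also have "\<dots> = (\<Sum>S\<in>M. of_bool (S \<subseteq> A))"
      by (rule sum.mono_neutral_cong_left) (auto simp: M_def)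
    also have "\<dots> = (\<Sum>S\<in>M. \<Prod>i\<in>S. x i)"
    proof (intro sum.cong refl)
      fix S assume "S \<in> M"
      then have S: "S \<subseteq> {1..n}" "finite S" using finite_subset by (auto simp: M_def)
      show "of_bool (S \<subseteq> A) = (\<Prod>i\<in>S. x i)"
      proof (cases "S \<subseteq> A")
        case True
        then have "(\<Prod>i\<in>S. x i) = 1" by (intro prod.neutral) (auto simp: A_def)
        then show ?thesis using True by simp
      next
        case False
        then obtain i where i: "i \<in> S" "i \<notin> A" by blast
        then have "x i = 0" using S(1) by (auto simp: A_def)
        then have "(\<Prod>i\<in>S. x i) = 0" using S(2) i(1) by (intro prod_zero) auto
        then show ?thesis using False by simp
      qed
    qed
    finally show ?thesis .
  qed
  moreover have "M \<subseteq> {S. S \<subseteq> {1..n} \<and> card S \<le> d}" by (auto simp: M_def)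
  ultimately show ?thesis unfolding low_degree_def by blast
qed

section \<open>The tester\<close>

definition round_queries :: "('v::ab_group_add list \<times> 'v list \<times> bool list) list \<Rightarrow> 'v list list" where
  "round_queries \<omega>s = concat (map batches \<omega>s)"

text \<open>The seeds fix all queries in advance. A run that meets an erasure accepts, hence
  functions of degree at most \<open>k + 1\<close> are not rejected on its account.\<close>

definition tester :: "nat \<Rightarrow> nat \<Rightarrow> nat \<Rightarrow> nat \<Rightarrow> (nat \<Rightarrow> bit, bit) algorithm" where
  "tester n k m s = Toss (map_pmf (\<lambda>\<omega>s. chain (map (to_cube n) (concat (round_queries \<omega>s)))
      (cautious_verdict (map (to_cube n) (concat (round_queries \<omega>s)))
        (\<lambda>h. \<exists>\<omega>\<in>set \<omega>s. rejects (\<lambda>x. h (to_cube n x)) \<omega>)))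
    (pmf_of_set (tuples m (cube.seeds n k s))))"

lemma hit_map:
  assumes "r ` W \<subseteq> X"
  shows "\<forall>B\<in>set Bs. set B \<subseteq> W \<Longrightarrow>
    hit (\<lambda>qs. {x \<in> X. P qs x}) (map r past) (map (map r) Bs) \<longleftrightarrow> hit (\<lambda>qs. {x \<in> W. P (map r qs) (r x)}) past Bs"
proof (induction Bs arbitrary: past)
  case (Cons B Bs)
  have "r ` set B \<inter> {x \<in> X. P (map r past) x} \<noteq> {} \<longleftrightarrow> set B \<inter> {x \<in> W. P (map r past) (r x)} \<noteq> {}"
    using Cons.prems assms by (force simp: image_subset_iff)
  then show ?case using Cons.IH[of "past @ B"] Cons.prems by simp
qed simp

lemma round_queries_facts:
  assumes "\<omega>s \<in> tuples m (cube.seeds n k s)"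
  shows "\<forall>B\<in>set (round_queries \<omega>s). length B = 2 ^ k \<and> set B \<subseteq> points n"
    and "length (concat (round_queries \<omega>s)) = m * (2 * s + 1) * 2 ^ k"
proof -
  have "\<forall>B\<in>set (batches \<omega>). length B = 2 ^ k \<and> set B \<subseteq> points n" if "\<omega> \<in> set \<omega>s" for \<omega>
  proof -
    have "\<omega> \<in> cube.seeds n k s" using assms that unfolding tuples_def by blast
    then show ?thesis using cube.batches_W(1,4)[of \<omega> n k s] by auto
  qed
  then show "\<forall>B\<in>set (round_queries \<omega>s). length B = 2 ^ k \<and> set B \<subseteq> points n"
    by (auto simp: round_queries_def)
  have "set \<omega>s \<subseteq> cube.seeds n k s" "length \<omega>s = m" using assms by (auto simp: tuples_def)
  then show "length (concat (round_queries \<omega>s)) = m * (2 * s + 1) * 2 ^ k"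
  proof (induction \<omega>s arbitrary: m)
    case (Cons \<omega> \<omega>s)
    then show ?case
      using cube.batches_W(3)[of \<omega> n k s] by (auto simp: round_queries_def algebra_simps)
  qed (simp add: round_queries_def)
qed

lemma seeds_tuples [simp]:
  "finite (tuples m (cube.seeds n k s))" "tuples m (cube.seeds n k s) \<noteq> {}"
  by simp_all

lemma tester_query_complexity: "query_complexity (tester n k m s) = enat (m * (2 * s + 1) * 2 ^ k)"
  unfolding tester_def by (rule query_complexity_Toss_chain) (auto simp: round_queries_facts(2) simp del: length_concat)

lemma tester_queried: "queried (tester n k m s) \<subseteq> cube n"
  unfolding tester_def by (subst queried_Toss_chain) auto

text \<open>The first oracle has no erasures, so every erased point counts in the Hamming distance
  that the budget bounds.\<close>

lemma erased_density:
  assumes adv: "erasure_budget_adversary (cube n) b t f A"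
    and qs: "set qs \<subseteq> points n" "length qs = i * b" "i \<le> N"
  shows "cube.dens n {x \<in> points n. A (map (to_cube n) qs) (to_cube n x) = None} \<le> real N * real t / 2 ^ n"
proof -
  let ?r = "to_cube n"
  have "cube.dens n {x \<in> points n. A (map ?r qs) (?r x) = None}
    = avg (points n) (\<lambda>x. of_bool (A (map ?r qs) (?r x) = None))"
    unfolding cube.dens_def by (intro avg_cong) auto
  also have "\<dots> = avg (cube n) (\<lambda>x. of_bool (A (map ?r qs) x = None))"
    by (rule avg_reindex[OF bij_to_cube])
  also have "\<dots> = real (card {x \<in> cube n. A (map ?r qs) x = None}) / 2 ^ n"
    by (simp add: avg_of_bool finite_cube card_cube)
  also have "card {x \<in> cube n. A (map ?r qs) x = None} \<le> hamming_dist (cube n) (A []) (A (map ?r qs))"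
    unfolding hamming_dist_def using adv finite_cube
    by (intro card_mono) (auto simp: erasure_budget_adversary_def)
  also have "\<dots> \<le> i * t"
    using adv qs unfolding erasure_budget_adversary_def by (metis (no_types, lifting) image_subsetI length_map list.set_map to_cube_mem)
  also have "\<dots> \<le> N * t" using qs by simp
  finally show ?thesis by (simp add: divide_right_mono)
qed

lemma far_from_imp:
  assumes "far_from (cube n) \<epsilon> (low_degree n d) f"
    and "\<And>hs x. hs \<in> tuples (Suc d) (points n) \<Longrightarrow> x \<in> points n \<Longrightarrow> iter_diff hs g x = 0"
  shows "\<epsilon> \<le> avg (points n) (\<lambda>x. of_bool (f (to_cube n x) \<noteq> g x))"
proof -
  let ?g = "\<lambda>x. g (of_cube n x)"
  have "avg (points n) (\<lambda>x. of_bool (f (to_cube n x) \<noteq> g x)) = avg (points n) (\<lambda>x. of_bool (f (to_cube n x) \<noteq> ?g (to_cube n x)))"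
    by (intro avg_cong) simp
  also have "\<dots> = avg (cube n) (\<lambda>x. of_bool (f x \<noteq> ?g x))"
    by (rule avg_reindex[OF bij_to_cube])
  also have "\<dots> = real (hamming_dist (cube n) f ?g) / real (card (cube n))"
    by (simp add: avg_of_bool finite_cube hamming_dist_def)
  finally have eq: "avg (points n) (\<lambda>x. of_bool (f (to_cube n x) \<noteq> g x))
    = real (hamming_dist (cube n) f ?g) / real (card (cube n))" .
  have "?g \<in> low_degree n d"
    by (rule iter_diff_imp_low_degree) (rule assms(2))
  then have "\<epsilon> * real (card (cube n)) \<le> real (hamming_dist (cube n) f ?g)"
    using assms(1) unfolding far_from_def by blast
  then show ?thesis unfolding eq card_cube by (simp add: field_simps)
qed

text \<open>When no erasure is met, the answers are the values of \<open>f\<close>. The verdict thus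
  depends on two events on the seeds, which can be bounded separately.\<close>

lemma tester_accept_prob:
  assumes adv: "erasure_budget_adversary (cube n) (2 ^ k) t f A"
  shows "pmf (run (2 ^ k) A (tester n k m s) []) v
    = avg (tuples m (cube.seeds n k s)) (\<lambda>\<omega>s. of_bool (
        (hit (\<lambda>qs. {x \<in> points n. A (map (to_cube n) qs) (to_cube n x) = None}) [] (round_queries \<omega>s)
          \<or> (\<forall>\<omega>\<in>set \<omega>s. \<not> rejects (\<lambda>x. f (to_cube n x)) \<omega>)) = v))"
  unfolding tester_def pmf_run_Toss_chain[OF seeds_tuples]
proof (intro avg_cong arg_cong[where f = of_bool] arg_cong[where f = "\<lambda>a. a = v"])
  fix \<omega>s assume \<omega>s: "\<omega>s \<in> tuples m (cube.seeds n k s)"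
  let ?r = "to_cube n" and ?Q = "map (to_cube n) (concat (round_queries \<omega>s))"
  let ?R = "\<lambda>h. \<exists>\<omega>\<in>set \<omega>s. rejects (\<lambda>x. h (to_cube n x)) \<omega>"
  note Q = round_queries_facts(1)[OF \<omega>s]
  have "cautious_verdict ?Q ?R (answers (2 ^ k) A [] ?Q) \<longleftrightarrow> None \<in> set (answers (2 ^ k) A [] ?Q) \<or> \<not> ?R f"
  proof (rule cautious_verdict_answers[OF adv])
    show "set ?Q \<subseteq> cube n" by auto
    fix g assume g: "\<And>x. x \<in> set ?Q \<Longrightarrow> g x = f x"
    have "rejects (\<lambda>x. g (?r x)) \<omega> = rejects (\<lambda>x. f (?r x)) \<omega>" if "\<omega> \<in> set \<omega>s" for \<omega>
    proof (rule rejects_cong)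
      fix x assume "x \<in> set (concat (batches \<omega>))"
      then have "x \<in> set (concat (round_queries \<omega>s))" using that by (auto simp: round_queries_def)
      then show "g (?r x) = f (?r x)" by (intro g) (simp only: set_map imageI)
    qed
    then show "?R g = ?R f" by blast
  qed
  also have "None \<in> set (answers (2 ^ k) A [] ?Q)
     \<longleftrightarrow> None \<in> set (answers (2 ^ k) A (map ?r []) (concat (map (map ?r) (round_queries \<omega>s))))"
    by (simp add: map_concat)
  also have "\<dots> \<longleftrightarrow> hit (\<lambda>qs. {x \<in> cube n. A qs x = None}) (map ?r []) (map (map ?r) (round_queries \<omega>s))"
    by (rule answers_None_iff_hit[where i = 0]) (use Q in auto)
  also have "\<dots> \<longleftrightarrow> hit (\<lambda>qs. {x \<in> points n. A (map ?r qs) (?r x) = None}) [] (round_queries \<omega>s)"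
    by (rule hit_map) (use Q in auto)
  finally show "cautious_verdict ?Q ?R (answers (2 ^ k) A [] ?Q) \<longleftrightarrow>
      hit (\<lambda>qs. {x \<in> points n. A (map ?r qs) (?r x) = None}) [] (round_queries \<omega>s)
      \<or> (\<forall>\<omega>\<in>set \<omega>s. \<not> rejects (\<lambda>x. f (?r x)) \<omega>)" by blast
qed

text \<open>A function of degree at most \<open>k + 1\<close> has affine differences in
  \<open>k\<close> directions, and the number \<open>2 * L + 1\<close> of selected points is
  odd.\<close>

lemma low_degree_not_rejected:
  assumes f: "f \<in> low_degree n (Suc k)" and \<omega>: "\<omega> \<in> cube.seeds n k (2 * L + 1)"
  shows "\<not> rejects (\<lambda>x. f (to_cube n x)) \<omega>"
proof -
  let ?f = "\<lambda>x. f (to_cube n x)"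
  obtain hs ys c where eq: "\<omega> = (hs, ys, c)" by (cases \<omega>)
  have *: "set hs \<subseteq> points n" "length hs = k" "set ys \<subseteq> points n" "length ys = 2 * length c" "odd (length c)"
    using \<omega> by (auto simp: eq cube.seeds_def tuples_def)
  have "iter_diff hs ?f (sum_list (sel c ys)) = sum_list (map (iter_diff hs ?f) (sel c ys))"
  proof (rule cube.affine_sum_list[where n = n])
    fix x a b assume "x \<in> points n" "a \<in> points n" "b \<in> points n"
    then show "iter_diff [a, b] (iter_diff hs ?f) x = 0"
      using low_degree_imp_iter_diff[OF f, of "[a, b] @ hs" x] *
      by (simp only: iter_diff_append) simp
  next
    show "set (sel c ys) \<subseteq> points n" using * set_sel[of c ys] by auto
    have "length (sel c ys) = length c" using *(4) by (induction c ys rule: sel.induct) auto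
    then show "odd (length (sel c ys))" using * by simp
  qed
  then show ?thesis by (simp add: eq rejects_def)
qed

text \<open>For a far function both failures, an erasure and the acceptance of all rounds, get
  probability at most 1/6. The value of \<open>m\<close> and the lower bound on \<open>L\<close> are
  for the second, the three bounds \<open>small\<close> for the first.\<close>

lemma tester_correct:
  fixes k m L t :: nat
  defines "s \<equiv> 2 * L + 1"
  defines "q \<equiv> m * (2 * s + 1) * 2 ^ k"
  assumes \<epsilon>: "\<epsilon> > 0" and L: "L \<ge> 1" and t: "t \<ge> 1" and m: "m = 120 * 4 ^ (k + 1)"
    and L\<epsilon>: "real L * (8 ^ (k + 1) * \<epsilon>) \<ge> 1"
    and small: "18 * (real q)\<^sup>2 * real t \<le> 2 ^ n" "162 * (real m)\<^sup>2 * real q * real t \<le> 2 ^ n"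
      "162 * (real m)\<^sup>2 * real q * real t \<le> 2 ^ s"
  shows "online_erasure_tester (cube n) (low_degree n (k + 1)) \<epsilon> (2 ^ k) t (tester n k m s)"
  unfolding online_erasure_tester_def
proof (intro conjI allI impI tester_queried)
  fix f :: "(nat \<Rightarrow> bit) \<Rightarrow> bit" and A :: "(nat \<Rightarrow> bit, bit) strategy"
  assume adv: "erasure_budget_adversary (cube n) (2 ^ k) t f A"
  let ?f = "\<lambda>x. f (to_cube n x)" and ?S = "tuples m (cube.seeds n k s)"
  define er where "er qs = {x \<in> points n. A (map (to_cube n) qs) (to_cube n x) = None}" for qs
  note prob = tester_accept_prob[OF adv, of m s, folded er_def]
  have m0: "m \<ge> 1" using m by simp
  {
    assume "f \<in> low_degree n (k + 1)"
    then have "\<forall>\<omega>\<in>set \<omega>s. \<not> rejects ?f \<omega>" if "\<omega>s \<in> ?S" for \<omega>s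
      using that low_degree_not_rejected[of f n k _ L] by (auto simp: tuples_def s_def)
    then have "pmf (run (2 ^ k) A (tester n k m s) []) True = avg ?S (\<lambda>_. 1)"
      unfolding prob by (intro avg_cong) simp
    then show "2 / 3 \<le> pmf (run (2 ^ k) A (tester n k m s) []) True" by (simp add: avg_const)
  }
  assume far: "far_from (cube n) \<epsilon> (low_degree n (k + 1)) f"
  have "avg ?S (\<lambda>\<omega>s. of_bool (\<forall>\<omega>\<in>set \<omega>s. \<not> rejects ?f \<omega>)) \<le> 1/6"
  proof (rule cube.all_rounds_accept)
    let ?p = "avg (cube.seeds n k s) (\<lambda>\<omega>. of_bool (rejects ?f \<omega>))"
    have "min (1 / (6 * 4 ^ (k + 2))) (min 1 (2 * real L * (2 ^ (k + 1) * \<epsilon>)) / 12) \<le> ?p"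
      unfolding s_def using far_from_imp[OF far] by (intro cube.rejects_prob \<epsilon> L) auto
    then have p: "real m * min (1 / (6 * 4 ^ (k + 2))) (min 1 (2 * real L * (2 ^ (k + 1) * \<epsilon>)) / 12) \<le> real m * ?p"
      by (rule mult_left_mono) simp
    have min: "5 \<le> real m * min a b" if "5 \<le> real m * a" "5 \<le> real m * b" for a b
      using that by (simp add: min_def)
    \<comment> \<open>Equality holds:
      \<open>120 * 4 ^ (k + 1) = 5 * (6 * 4 ^ (k + 2))\<close>.\<close>
    have "5 \<le> real m * (1 / (6 * 4 ^ (k + 2)))" by (simp add: m field_simps)
    moreover have "5 \<le> real m * (min 1 (2 * real L * (2 ^ (k + 1) * \<epsilon>)) / 12)"
    proof -
      have "(5::real) \<le> 10 * 4 ^ (k + 1)" using one_le_power[of "4::real" k] by (simp, linarith)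
      moreover have "5 \<le> 20 * (real L * (8 ^ (k + 1) * \<epsilon>))" using L\<epsilon> by linarith
      moreover have "(4::real) ^ (k + 1) * 2 ^ (k + 1) = 8 ^ (k + 1)"
        by (simp flip: power_mult_distrib)
      ultimately show ?thesis by (auto simp: m min_def algebra_simps)
    qed
    ultimately show "5 \<le> real m * ?p" using min p by (meson order_trans)
  qed
  moreover have "avg ?S (\<lambda>\<omega>s. of_bool (hit er [] (round_queries \<omega>s))) \<le> 1/6"
  proof -
    define N where "N = m * (2 * s + 1)"
    define \<kappa> where "\<kappa> = real N * real t / 2 ^ n"
    \<comment> \<open>This choice makes the middle term of the bound below,
      \<open>m * \<nu> * (q * t) / 2\<close>, equal to 1/18; each of the three terms gets at most
      1/18.\<close>
    define \<nu> where "\<nu> = 1 / (9 * real m * real q * real t)"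
    have q: "q = N * 2 ^ k" by (simp add: q_def N_def)
    then have q0: "q \<ge> 1" using m0 by (simp add: N_def)
    have \<nu>: "\<nu> > 0" using m0 q0 t by (simp add: \<nu>_def)
    have \<kappa>: "2 ^ k * \<kappa> = real q * real t / 2 ^ n" by (simp add: \<kappa>_def q)
    have "avg ?S (\<lambda>\<omega>s. of_bool (hit er [] (round_queries \<omega>s))) \<le> real m * cube.hit_bound n k \<kappa> s \<nu>"
      unfolding round_queries_def
    proof (rule cube.rounds_hit[where N = N and i = 0])
      fix i and qs :: "(nat \<Rightarrow> bit) list" assume "set qs \<subseteq> points n" "length qs = i * 2 ^ k" "i \<le> N"
      then show "cube.dens n (er qs) \<le> \<kappa>"
        unfolding er_def \<kappa>_def by (rule erased_density[OF adv])
    qed (auto simp: \<nu> N_def)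
    also have "\<dots> = real (m * (2 * s) * 2 ^ k) * (real N * real t / 2 ^ n)
       + real m * \<nu> * (real q * real t) / 2 + real m / (2 * \<nu>) * ((1/2) ^ s + 1 / 2 ^ n)"
      unfolding cube.hit_bound_def \<kappa> card_points using \<nu> by (simp add: field_simps \<kappa>_def q)
    also have "real (m * (2 * s) * 2 ^ k) * (real N * real t / 2 ^ n) \<le> real q * (real q * real t / 2 ^ n)"
    proof (intro mult_mono divide_right_mono)
      show "real (m * (2 * s) * 2 ^ k) \<le> real q" unfolding q_def of_nat_le_iff by (intro mult_mono) auto
      show "real N \<le> real q" unfolding q of_nat_le_iff by simp
    qed auto
    also have "real q * (real q * real t / 2 ^ n) \<le> 1 / 18"
      using small(1) by (simp add: field_simps power2_eq_square)
    also have "real m * \<nu> * (real q * real t) / 2 = 1 / 18"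
      using m0 q0 t by (simp add: \<nu>_def)
    also have "real m / (2 * \<nu>) * ((1/2) ^ s + 1 / 2 ^ n) \<le> 1 / 18"
    proof -
      let ?y = "162 * (real m)\<^sup>2 * real q * real t"
      have "real m / (2 * \<nu>) * ((1/2) ^ s + 1 / 2 ^ n) = (?y / 2 ^ s + ?y / 2 ^ n) / 36"
        by (simp add: \<nu>_def power2_eq_square field_simps)
      also have "\<dots> \<le> (1 + 1) / 36"
        using small by (intro divide_right_mono add_mono) auto
      finally show ?thesis by simp
    qed
    finally show ?thesis by simp
  qed
  ultimately have *: "avg ?S (\<lambda>\<omega>s. of_bool (hit er [] (round_queries \<omega>s)) + of_bool (\<forall>\<omega>\<in>set \<omega>s. \<not> rejects ?f \<omega>)) \<le> 1/3"
    unfolding avg_add by linarith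
  have "2 / 3 \<le> avg ?S (\<lambda>\<omega>s. 1 - (of_bool (hit er [] (round_queries \<omega>s)) + of_bool (\<forall>\<omega>\<in>set \<omega>s. \<not> rejects ?f \<omega>)))"
    using * unfolding avg_diff by (simp add: avg_const)
  also have "\<dots> \<le> pmf (run (2 ^ k) A (tester n k m s) []) False"
    unfolding prob by (intro avg_mono) auto
  finally show "2 / 3 \<le> pmf (run (2 ^ k) A (tester n k m s) []) False" .
qed

section \<open>Choice of the parameters\<close>

text \<open>\<open>L\<close> has two summands: the first gives
  \<open>L * (8 ^ d * \<epsilon>) \<ge> 1\<close>, the second makes \<open>2 ^ s\<close> large
  against the number of queries and \<open>t\<close>.\<close>

lemma tester_parameters:
  fixes n d t L q m s :: nat and \<epsilon> l :: real
  defines "l \<equiv> log 2 (real (max t 2))"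
  defines "L \<equiv> nat \<lceil>1 / (8 ^ d * \<epsilon>) + 36 * (real d + l)\<rceil>"
  defines "s \<equiv> 2 * L + 1" and "m \<equiv> 120 * 4 ^ d"
  defines "q \<equiv> m * (2 * s + 1) * 2 ^ (d - 1)"
  assumes d: "d \<ge> 1" and \<epsilon>: "0 < \<epsilon>" "\<epsilon> < 1/2" and dn: "real d < real n / 11"
    and H: "real (max t 2) * l ^ 7
      \<le> 1 / 10 ^ 11 * \<epsilon> powr (5/2) * real d powr (-7) * 2 powr ((real n - 11 * real d) / 2)"
  shows "L \<ge> 1" "real L * (8 ^ d * \<epsilon>) \<ge> 1"
    "real q \<le> 8880 * (1 / \<epsilon> + 8 ^ d * (real d + l))"
    "18 * (real q)\<^sup>2 * real t \<le> 2 ^ n"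
    "162 * (real m)\<^sup>2 * real q * real t \<le> 2 ^ n"
    "162 * (real m)\<^sup>2 * real q * real t \<le> 2 ^ s"
proof -
  let ?tb = "real (max t 2)"
  define X where "X = (2::real) powr ((real n - 11 * real d) / 2)"
  \<comment> \<open>The constant \<open>10 ^ 11\<close> exceeds \<open>18 * 26640 ^ 2\<close> and
    \<open>2332800 * 26640\<close>, which arise below.\<close>
  define u where "u = X / 10 ^ 11"
  define z where "z = real d * l"
  have l: "l \<ge> 1" unfolding l_def by simp
  have dl: "real d \<ge> 1" using d by simp
  have z: "z \<ge> 1" unfolding z_def using l dl mult_mono[of 1 "real d" 1 l] by simp
  have X: "X \<ge> 1" unfolding X_def using dn by (intro ge_one_powr_ge_zero) auto
  have e8: "(8::real) ^ d * \<epsilon> > 0" using \<epsilon> by simp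
  define x where "x = 1 / (8 ^ d * \<epsilon>) + 36 * (real d + l)"
  have x: "x \<ge> 1 / (8 ^ d * \<epsilon>)" "x \<ge> 36 * (real d + l)" "x \<ge> 0"
    using e8 l dl by (auto simp: x_def)
  have Lx: "real L \<ge> x" "real L \<le> x + 1"
    using x(3) unfolding L_def x_def[symmetric] by (simp_all add: of_nat_nat)
  have "real L \<ge> 1" using Lx(1) x(2) l dl by auto
  then show "L \<ge> 1" by simp
  show "real L * (8 ^ d * \<epsilon>) \<ge> 1"
    using order_trans[OF x(1) Lx(1)] e8 by (simp add: divide_le_eq)
  have q: "real q = 60 * 8 ^ d * (4 * real L + 3)"
  proof -
    obtain k where k: "d = Suc k" using d by (cases d) auto
    have "(8::real) ^ k = 4 ^ k * 2 ^ k" by (simp flip: power_mult_distrib)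
    then show ?thesis unfolding q_def s_def m_def k by (simp add: algebra_simps)
  qed
  show qC: "real q \<le> 8880 * (1 / \<epsilon> + 8 ^ d * (real d + l))"
  proof -
    have "real q \<le> 60 * 8 ^ d * (4 * (x + 1) + 3)"
      unfolding q using Lx(2) by (intro mult_left_mono) auto
    also have "\<dots> = 240 / \<epsilon> + 60 * 8 ^ d * (144 * (real d + l) + 7)"
      using \<epsilon> by (simp add: x_def field_simps)
    \<comment> \<open>The 7 is absorbed since \<open>d + l \<ge> 2\<close>; both summands then get
      the constant \<open>8880 = 60 * 148\<close>.\<close>
    also have "\<dots> \<le> 8880 / \<epsilon> + 60 * 8 ^ d * (148 * (real d + l))"
      using \<epsilon> l dl by (intro add_mono mult_left_mono divide_right_mono) auto
    finally show ?thesis by (simp add: algebra_simps)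
  qed
  have tz: "real t * z ^ 7 \<le> u * \<epsilon>\<^sup>2"
  proof -
    have "real t * z ^ 7 \<le> ?tb * l ^ 7 * real d ^ 7"
      unfolding z_def power_mult_distrib using l by (simp add: mult_ac mult_right_mono)
    also have "\<dots> \<le> (1 / 10 ^ 11 * \<epsilon> powr (5/2) * real d powr (-7) * X) * real d ^ 7"
      unfolding X_def by (intro mult_right_mono H) simp
    also have "\<dots> = u * \<epsilon> powr (5/2)"
      using dl by (simp add: u_def powr_minus powr_numeral field_simps)
    also have "\<dots> \<le> u * \<epsilon> powr 2"
      using \<epsilon> X by (intro mult_left_mono powr_mono') (auto simp: u_def)
    finally show ?thesis using \<epsilon> by (simp add: powr_numeral)
  qed
  have tz': "real t * z ^ i \<le> u * \<epsilon>\<^sup>2" if "i \<le> 7" for i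
    using tz mult_left_mono[OF power_increasing[OF that z], of "real t"] by simp
  have qz: "real q \<le> 26640 * 8 ^ d * z / \<epsilon>"
  proof -
    have "real d \<le> z" "l \<le> z"
      using l dl by (simp_all add: z_def mult_le_cancel_left1 mult_le_cancel_right1)
    then have "real d + l \<le> 2 * z" by linarith
    then have "8 ^ d * (real d + l) \<le> 8 ^ d * (2 * z)" by simp
    also have "\<dots> \<le> 8 ^ d * (2 * z) / \<epsilon>"
      using \<epsilon> z mult_left_mono[of \<epsilon> 1 "8 ^ d * (2 * z)"] by (simp add: field_simps)
    finally have "8 ^ d * (real d + l) \<le> 8 ^ d * (2 * z) / \<epsilon>" .
    moreover have "1 / \<epsilon> \<le> 8 ^ d * z / \<epsilon>"
      using \<epsilon> z mult_mono[of 1 "8 ^ d" 1 z] by (intro divide_right_mono) auto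
    ultimately have "1 / \<epsilon> + 8 ^ d * (real d + l) \<le> 3 * (8 ^ d * z / \<epsilon>)" by simp
    then show ?thesis using qC by simp
  qed
  \<comment> \<open>The 11 in the exponent becomes \<open>2048 = 2 ^ 11\<close>;
    \<open>2048 ^ d\<close> dominates the factors \<open>64 ^ d\<close> and \<open>128 ^ d\<close>
    that come from \<open>q ^ 2\<close> and \<open>m ^ 2 * q\<close>.\<close>
  have X2: "2 ^ n = 2048 ^ d * X * X"
  proof -
    have "(2::real) ^ n = 2 powr (real (11 * d) + ((real n - 11 * real d) / 2 + (real n - 11 * real d) / 2))"
      by (simp add: powr_realpow flip: powr_realpow)
    also have "\<dots> = 2 ^ (11 * d) * (X * X)"
      unfolding X_def by (simp only: powr_add powr_realpow zero_less_numeral)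
    also have "(2::real) ^ (11 * d) = 2048 ^ d" by (simp add: power_mult)
    finally show ?thesis by simp
  qed
  have le_2n: "a ^ d * X \<le> 2 ^ n" if "0 \<le> a" "a \<le> 2048" for a
    unfolding X2 using X that mult_mono[of "a ^ d * X" "2048 ^ d * X" 1 X]
    by (auto intro!: mult_right_mono power_mono)
  show "18 * (real q)\<^sup>2 * real t \<le> 2 ^ n"
  proof -
    have "18 * (real q)\<^sup>2 * real t \<le> 18 * (26640 * 8 ^ d * z / \<epsilon>)\<^sup>2 * real t"
      using qz by (intro mult_right_mono mult_left_mono power_mono) auto
    also have "\<dots> = 18 * 26640\<^sup>2 * 64 ^ d * (real t * z\<^sup>2) / \<epsilon>\<^sup>2"
      using power_mult[of "8::real" 2 d] power_mult[of "8::real" d 2]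
      by (simp add: power_mult_distrib power_divide mult.commute[of d 2])
    also have "\<dots> \<le> 18 * 26640\<^sup>2 * 64 ^ d * (u * \<epsilon>\<^sup>2) / \<epsilon>\<^sup>2"
      by (intro divide_right_mono mult_left_mono tz') auto
    also have "\<dots> \<le> 64 ^ d * X" using \<epsilon> X by (simp add: u_def)
    also have "\<dots> \<le> 2 ^ n" by (rule le_2n) auto
    finally show ?thesis .
  qed
  have m2: "162 * (real m)\<^sup>2 = 2332800 * 16 ^ d"
    using power_mult[of "4::real" 2 d] power_mult[of "4::real" d 2]
    by (simp add: m_def power_mult_distrib mult.commute[of d 2])
  show "162 * (real m)\<^sup>2 * real q * real t \<le> 2 ^ n"
  proof -
    have "162 * (real m)\<^sup>2 * real q * real t \<le> 2332800 * 16 ^ d * (26640 * 8 ^ d * z / \<epsilon>) * real t"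
      unfolding m2 by (intro mult_right_mono mult_left_mono qz) auto
    also have "\<dots> = 62145792000 * (16 ^ d * 8 ^ d) * (real t * z ^ 1) / \<epsilon>"
      by simp
    also have "\<dots> = 62145792000 * 128 ^ d * (real t * z ^ 1) / \<epsilon>"
      by (simp flip: power_mult_distrib)
    also have "\<dots> \<le> 62145792000 * 128 ^ d * (u * \<epsilon>\<^sup>2) / \<epsilon>"
      using \<epsilon> by (intro divide_right_mono mult_left_mono tz') auto
    also have "\<dots> = 62145792000 * 128 ^ d * u * \<epsilon>"
      using \<epsilon> by (simp add: power2_eq_square)
    also have "\<dots> \<le> 62145792000 * 128 ^ d * u * 1"
      using \<epsilon> X by (intro mult_left_mono) (auto simp: u_def)
    also have "\<dots> \<le> 128 ^ d * X" using X by (simp add: u_def)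
    also have "\<dots> \<le> 2 ^ n" by (rule le_2n) auto
    finally show ?thesis .
  qed
  show "162 * (real m)\<^sup>2 * real q * real t \<le> 2 ^ s"
  proof -
    \<comment> \<open>As \<open>s = 2 * L + 1\<close>, one factor \<open>2 ^ L\<close> pays for the
      factor \<open>4 * L + 3\<close> of \<open>q\<close>, the other for
      \<open>2 ^ (30 + 7 * d)\<close> and \<open>t\<close>, because
      \<open>L \<ge> 36 * (d + l)\<close>.\<close>
    have "Suc L \<le> 2 ^ L" by (simp add: Suc_le_eq)
    then have "real (Suc L) \<le> real (2 ^ L)" by (simp only: of_nat_le_iff)
    then have L2: "4 * real L + 3 \<le> 4 * 2 ^ L" by simp
    have t: "real t \<le> 2 powr l" by (simp add: l_def)
    have "162 * (real m)\<^sup>2 * real q * real t \<le> 2332800 * 16 ^ d * (60 * 8 ^ d * (4 * 2 ^ L)) * 2 powr l"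
      unfolding m2 q by (intro mult_mono mult_left_mono L2 t) auto
    also have "\<dots> = 559872000 * (16 ^ d * 8 ^ d) * 2 ^ L * 2 powr l" by simp
    also have "(16::real) ^ d * 8 ^ d = 2 ^ (7 * d)" by (simp add: power_mult flip: power_mult_distrib)
    also have "559872000 * (2::real) ^ (7 * d) * 2 ^ L * 2 powr l \<le> 2 ^ 30 * 2 ^ (7 * d) * 2 ^ L * 2 powr l"
      by (intro mult_right_mono) auto
    also have "\<dots> = 2 powr (real (30 + 7 * d + L) + l)"
      by (simp only: powr_add powr_realpow power_add zero_less_numeral of_nat_add)
    also have "\<dots> \<le> 2 powr real s"
      using Lx(1) x(2) l dl by (intro powr_mono) (auto simp: s_def)
    also have "\<dots> = 2 ^ s" by (simp add: powr_realpow)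
    finally show ?thesis .
  qed
qed

theorem theorem1p3:
  "\<exists>c C :: real. c > 0 \<and> C > 0 \<and>
     (\<forall>(n::nat) (d::nat) (\<epsilon>::real) (t::nat).
        n \<ge> 1 \<longrightarrow> d \<ge> 1 \<longrightarrow> 0 < \<epsilon> \<longrightarrow> \<epsilon> < 1/2 \<longrightarrow> t \<ge> 1 \<longrightarrow>
        (let tb = real (max t 2) in
           real d < real n / 11 \<longrightarrow>
           tb * (log 2 tb) ^ 7
             \<le> c * \<epsilon> powr (5/2) * real d powr (-7) * 2 powr ((real n - 11 * real d) / 2) \<longrightarrow>
           (\<exists>(T :: (nat \<Rightarrow> bit, bit) algorithm) (q::nat).
              online_erasure_tester (cube n) (low_degree n d) \<epsilon> (2 ^ (d - 1)) t T \<and>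
              query_complexity T = enat q \<and>
              real q \<le> C * (1 / \<epsilon> + 2 ^ (3 * d) * (real d + log 2 tb) ^ 3))))"
proof (intro exI conjI allI impI)
  show "(0::real) < 1 / 10 ^ 11" "(0::real) < 8880" by simp_all
  fix n d t :: nat and \<epsilon> :: real
  assume n: "n \<ge> 1" and d: "d \<ge> 1" and \<epsilon>: "0 < \<epsilon>" "\<epsilon> < 1/2" and t: "t \<ge> 1"
  let ?l = "log 2 (real (max t 2))"
  define L where "L = nat \<lceil>1 / (8 ^ d * \<epsilon>) + 36 * (real d + ?l)\<rceil>"
  define s where "s = 2 * L + 1"
  define m :: nat where "m = 120 * 4 ^ d"
  define q where "q = m * (2 * s + 1) * 2 ^ (d - 1)"
  obtain k where k: "d = k + 1" using d by (cases d) auto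
  show "let tb = real (max t 2) in
     real d < real n / 11 \<longrightarrow>
     tb * (log 2 tb) ^ 7
       \<le> 1 / 10 ^ 11 * \<epsilon> powr (5/2) * real d powr (-7) * 2 powr ((real n - 11 * real d) / 2) \<longrightarrow>
     (\<exists>(T :: (nat \<Rightarrow> bit, bit) algorithm) (q::nat).
        online_erasure_tester (cube n) (low_degree n d) \<epsilon> (2 ^ (d - 1)) t T \<and>
        query_complexity T = enat q \<and>
        real q \<le> 8880 * (1 / \<epsilon> + 2 ^ (3 * d) * (real d + log 2 tb) ^ 3))"
    unfolding Let_def
  proof (intro impI exI conjI)
    assume "real d < real n / 11"
      "real (max t 2) * ?l ^ 7
       \<le> 1 / 10 ^ 11 * \<epsilon> powr (5/2) * real d powr (-7) * 2 powr ((real n - 11 * real d) / 2)"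
    note P = tester_parameters[OF d \<epsilon> this, folded L_def, folded s_def m_def, folded q_def]
    show "online_erasure_tester (cube n) (low_degree n d) \<epsilon> (2 ^ (d - 1)) t (tester n k m s)"
      using tester_correct[OF \<epsilon>(1) P(1) t, of m k n] P
      by (simp add: k m_def s_def q_def)
    show "query_complexity (tester n k m s) = enat q"
      by (simp add: tester_query_complexity q_def k)
    have "?l \<ge> 1" by simp
    then have y: "real d + ?l \<ge> 1" by linarith
    \<comment> \<open>The bound on \<open>q\<close> is linear in \<open>d + ?l\<close>; the cube in
      the claim dominates it.\<close>
    have "real d + ?l \<le> (real d + ?l) ^ 3" using y by (intro self_le_power) auto
    then have "8 ^ d * (real d + ?l) \<le> 2 ^ (3 * d) * (real d + ?l) ^ 3"
      by (simp add: power_mult)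
    then show "real q \<le> 8880 * (1 / \<epsilon> + 2 ^ (3 * d) * (real d + ?l) ^ 3)"
      using P(3) by simp
  qed
qed

end
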